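(* Let $0<\alpha<1$ and consider the problem described in the context with the latent heat $\ell$ unknown (Case 2), the data $k,\rho,c>0$, $T_m$, $T_0>T_m$, $q_0>0$ being given. If $$\frac{\sqrt{\rho c k}\,(T_0-T_m)}{q_0\,\Gamma\left(1-\frac{\alpha}{2}\right)}<1,$$ then the equation $$1-W\left(-x;-\frac{\alpha}{2},1\right)=\frac{\sqrt{\rho c k}\,(T_0-T_m)}{q_0\,\Gamma\left(1-\frac{\alpha}{2}\right)},\quad x>0,$$ has a unique solution $\xi_\alpha>0$, and the solution of Case 2 is given by $$\ell=\ell_\alpha=\frac{c(T_0-T_m)\,\Gamma\left(1-\frac{\alpha}{2}\right)}{\Gamma\left(1+\frac{\alpha}{2}\right)F_{4\alpha}(\xi_\alpha)},\qquad F_{4\alpha}(x)=\frac{x\left[1-W\left(-x;-\frac{\alpha}{2},1\right)\right]}{M_{\alpha/2}(x)},$$ $$T_\alpha(x,t)=T_0-\frac{T_0-T_m}{1-W\left(-\xi_\alpha;-\frac{\alpha}{2},1\right)}\left[1-W\left(-\frac{x}{\lambda_\alpha t^{\alpha/2}};-\frac{\alpha}{2},1\right)\right],\qquad s_\alpha(t)=\lambda\xi_\alpha t^{\alpha/2},$$ with $\lambda_\alpha^2=\lambda^2=\frac{k}{\rho c}$.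
   Context: For $0<\alpha<1$ the Caputo fractional derivative of a function $f$ of $t$ is $D^\alpha f(t)=\frac{1}{\Gamma(1-\alpha)}\int_0^t \frac{f'(\tau)}{(t-\tau)^\alpha}\,d\tau$, where $\Gamma$ is Euler's Gamma function. The Wright function is $W(z;a,b)=\sum_{n=0}^{\infty}\frac{z^n}{n!\,\Gamma(na+b)}$ for $z\in\mathbb{C}$, $a>-1$, $b\in\mathbb{R}$; the Mainardi function is $M_\nu(z)=W(-z;-\nu,1-\nu)$ for $\nu<1$. The problem: $\rho,k,c,\ell$ are positive constants (density, conductivity, specific heat, latent heat), $\lambda^2=k/(\rho c)$, $T_m$ is the melting temperature, $T_0>T_m$ and $q_0>0$ are constants. Find $x=s(t)$, $T=T(x,t)$ and the unknown coefficient such that: $D^\alpha T=\lambda^2 T_{xx}$ for $0<x<s(t)$, $t>0$ (Caputo derivative in $t$); $s(0)=0$; $T(x,0)=T(+\infty,t)=T_m$ for $x>0,t>0$; $T(s(t),t)=T_m$; $-kT_x(s(t),t)=\rho\ell\, D^\alpha s(t)$; $T(0,t)=T_0$; $kT_x(0,t)=-q_0/t^{\alpha/2}$, for all $t>0$.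
   Formalization: T_α itself violates T(x,0)=T(+∞,t)=T_m (its limit is below T_m), so these conditions are read for the temperature set equal to T_m where x>s(t), the other conditions for T_α; "the solution" means that the explicit triple satisfies the problem. *)

theory Defs
  imports "HOL-Analysis.Analysis"
begin

definition wright :: "real \<Rightarrow> real \<Rightarrow> real \<Rightarrow> real" where
  "wright z a b = (\<Sum>n. z ^ n / (fact n * Gamma (real n * a + b)))"

definition mainardi :: "real \<Rightarrow> real \<Rightarrow> real" where
  "mainardi \<nu> z = wright (- z) (- \<nu>) (1 - \<nu>)"

definition caputo :: "real \<Rightarrow> (real \<Rightarrow> real) \<Rightarrow> real \<Rightarrow> real" where
  "caputo \<alpha> f t = integral {0..t} (\<lambda>\<tau>. deriv f \<tau> / (t - \<tau>) powr \<alpha>) / Gamma (1 - \<alpha>)"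

definition caputo_exists :: "real \<Rightarrow> (real \<Rightarrow> real) \<Rightarrow> real \<Rightarrow> bool" where
  "caputo_exists \<alpha> f t \<longleftrightarrow>
     (\<forall>\<tau>\<in>{0<..<t}. f differentiable (at \<tau>)) \<and>
     (\<lambda>\<tau>. deriv f \<tau> / (t - \<tau>) powr \<alpha>) integrable_on {0..t}"

text \<open>Temperature on the whole half-line for the one-phase problem: the liquid temperature T
  on 0 <= x <= s(t), and the melting temperature in the solid region x > s(t).\<close>
definition one_phase_temp ::
  "(real \<Rightarrow> real \<Rightarrow> real) \<Rightarrow> (real \<Rightarrow> real) \<Rightarrow> real \<Rightarrow> real \<Rightarrow> real \<Rightarrow> real" where
  "one_phase_temp T s Tm x t = (if x \<le> s t then T x t else Tm)"

definition stefan_case2 ::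
  "real \<Rightarrow> real \<Rightarrow> real \<Rightarrow> real \<Rightarrow> real \<Rightarrow> real \<Rightarrow> real \<Rightarrow>
   real \<Rightarrow> (real \<Rightarrow> real \<Rightarrow> real) \<Rightarrow> (real \<Rightarrow> real) \<Rightarrow> bool" where
  "stefan_case2 \<alpha> \<rho> k c Tm T0 q0 L T s \<longleftrightarrow>
     L > 0 \<and>
     (\<forall>t>0. \<forall>y. (\<lambda>z. T z t) differentiable (at y)) \<and>
     (\<forall>t>0. \<forall>x. 0 < x \<and> x < s t \<longrightarrow>
        caputo_exists \<alpha> (\<lambda>\<tau>. T x \<tau>) t \<and>
        deriv (\<lambda>z. T z t) differentiable (at x) \<and>
        caputo \<alpha> (\<lambda>\<tau>. T x \<tau>) t = (k / (\<rho> * c)) * deriv (deriv (\<lambda>z. T z t)) x) \<and>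
     s 0 = 0 \<and>
     (\<forall>x>0. one_phase_temp T s Tm x 0 = Tm) \<and>
     (\<forall>t>0. ((\<lambda>x. one_phase_temp T s Tm x t) \<longlongrightarrow> Tm) at_top) \<and>
     (\<forall>t>0. T (s t) t = Tm) \<and>
     (\<forall>t>0. caputo_exists \<alpha> s t \<and>
        - k * deriv (\<lambda>z. T z t) (s t) = \<rho> * L * caputo \<alpha> s t) \<and>
     (\<forall>t>0. T 0 t = T0) \<and>
     (\<forall>t>0. k * deriv (\<lambda>z. T z t) 0 = - q0 / t powr (\<alpha> / 2))"

definition lam :: "real \<Rightarrow> real \<Rightarrow> real \<Rightarrow> real" where
  "lam \<rho> k c = sqrt (k / (\<rho> * c))"

definition F4 :: "real \<Rightarrow> real \<Rightarrow> real" where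
  "F4 \<alpha> x = x * (1 - wright (- x) (- \<alpha> / 2) 1) / mainardi (\<alpha> / 2) x"

definition ell_sol :: "real \<Rightarrow> real \<Rightarrow> real \<Rightarrow> real \<Rightarrow> real \<Rightarrow> real" where
  "ell_sol \<alpha> c Tm T0 \<xi> =
     c * (T0 - Tm) * Gamma (1 - \<alpha> / 2) / (Gamma (1 + \<alpha> / 2) * F4 \<alpha> \<xi>)"

definition T_sol :: "real \<Rightarrow> real \<Rightarrow> real \<Rightarrow> real \<Rightarrow> real \<Rightarrow> real \<Rightarrow> real \<Rightarrow> real \<Rightarrow> real \<Rightarrow> real" where
  "T_sol \<alpha> \<rho> k c Tm T0 \<xi> x t =
     T0 - (T0 - Tm) / (1 - wright (- \<xi>) (- \<alpha> / 2) 1) *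
          (1 - wright (- (x / (lam \<rho> k c * t powr (\<alpha> / 2)))) (- \<alpha> / 2) 1)"

definition s_sol :: "real \<Rightarrow> real \<Rightarrow> real \<Rightarrow> real \<Rightarrow> real \<Rightarrow> real \<Rightarrow> real" where
  "s_sol \<alpha> \<rho> k c \<xi> t = lam \<rho> k c * \<xi> * t powr (\<alpha> / 2)"

end

theory Submission
  imports Defs "HOL-Complex_Analysis.Complex_Analysis" "HOL-Real_Asymp.Real_Asymp"
begin

text \<open>
  Put \<open>\<nu> = \<alpha> / 2 < 1 / 2\<close>. Expanding the exponential shows that
  \<open>t\<^bsup>b-1\<^esup> W(-y t\<^bsup>-\<nu>\<^esup>; -\<nu>, b)\<close> with \<open>b < 1\<close> is the Laplace integral of the imaginary
  part of \<open>exp (i \<pi> b) r\<^bsup>-b\<^esup> exp (-y r\<^bsup>\<nu>\<^esup> exp (-i \<pi> \<nu>)) / \<pi>\<close>. A residue computation then gives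
  its own Laplace transform in \<open>t\<close>, namely \<open>s\<^bsup>-b\<^esup> exp (-y s\<^bsup>\<nu>\<^esup>)\<close>. For \<open>b = 0\<close> this is completely
  monotone, so the Mainardi function is nonnegative. Uniqueness of Laplace transforms identifies the
  Abel integral of order \<open>\<alpha>\<close> of the \<open>b = 0\<close> function with \<open>\<Gamma>(1 - \<alpha>)\<close> times the
  \<open>b = 1 - \<alpha>\<close> function: this is the fractional heat equation, and it also makes the Mainardi
  function decreasing, hence, being entire and nonzero, strictly positive. Finally
  \<open>exp (-s\<^bsup>\<nu>\<^esup>) \<rightarrow> 1\<close> as \<open>s \<rightarrow> 0\<close> forces \<open>sup (1 - W(-x; -\<nu>, 1)) \<ge> 1\<close>, so the equation for \<open>\<xi>\<close> is
  solvable.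
\<close>

subsection \<open>Exponential forms of the Gamma integral\<close>

text \<open>The problem asks for \<open>b = 1\<close>, but evaluating the Laplace integral term by
  term needs \<open>b < 1\<close>. The gap is bridged by differentiation: the time derivative of
  \<open>W(-y / t powr \<nu>; -\<nu>, 1)\<close> is the profile with \<open>b = 0\<close>, so the
  Caputo derivative of the temperature is an Abel integral of that profile. The bound
  \<open>\<nu> < 1 / 2\<close> acts twice: \<open>cos (pi * \<nu>) > 0\<close> makes the kernel
  decay without help from \<open>exp (-t r)\<close>, and the Abel order \<open>2 * \<nu>\<close>
  stays below 1. Nonnegativity and uniqueness rest on one result, a Bernstein approximation in the
  variable \<open>exp (-t)\<close>: uniqueness is nonnegativity applied to a difference and to its
  negative. The Gamma factors of the latent heat come from the Caputo derivative of order
  \<open>2 * \<nu>\<close> of \<open>t powr \<nu>\<close>, whose constant is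
  \<open>Gamma (1 + \<nu>) / Gamma (1 - \<nu>)\<close>.\<close>

lemma has_bochner_integral_Gamma_exp:
  fixes p t :: real
  assumes p: "p > 0" and t: "t > 0"
  shows "has_bochner_integral lborel (\<lambda>x. exp (p * x - t * exp x)) (Gamma p * t powr (- p))"
proof -
  define f where "f = (\<lambda>u::real. u powr (p - 1) / exp u)"
  have f1: "(f has_integral Gamma p) {0..}"
    unfolding f_def by (rule Gamma_integral_real[OF p])
  \<comment> \<open>Without the endpoint, the domain is exactly the range of the substitution
    \<open>u = t * exp x\<close>.\<close>
  have "(f has_integral Gamma p) {0<..}"
  proof (rule has_integral_spike_set_eq[THEN iffD1, OF _ _ f1])
    show "negligible {x \<in> {0..} - {0<..}. f x \<noteq> 0}"
      by (rule negligible_subset[of "{0}"]) auto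
  qed (auto intro: negligible_subset[of "{}"])
  hence f2: "f absolutely_integrable_on {0<..}" "integral {0<..} f = Gamma p"
    by (auto intro!: nonnegative_absolutely_integrable_1 simp: f_def integrable_on_def)
  have rng: "range (\<lambda>x. t * exp x) = {0<..}"
  proof (intro set_eqI iffI)
    fix u :: real assume u: "u \<in> {0<..}"
    hence "u = t * exp (ln (u / t))" using t by simp
    thus "u \<in> range (\<lambda>x. t * exp x)" by blast
  qed (use t in auto)
  have "(\<lambda>x. \<bar>t * exp x\<bar> * f (t * exp x)) absolutely_integrable_on UNIV \<and>
        integral UNIV (\<lambda>x. \<bar>t * exp x\<bar> * f (t * exp x)) = Gamma p"
    by (subst has_absolute_integral_change_of_variables_1')
       (use t f2 rng in \<open>auto intro!: derivative_eq_intros injI\<close>)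
  moreover have "\<bar>t * exp x\<bar> * f (t * exp x) = t powr p * exp (p * x - t * exp x)" for x
  proof -
    have "(t * exp x) powr p = t powr p * exp (p * x)"
      using t by (simp add: powr_mult) (simp add: powr_def)
    moreover have "(t * exp x) powr p = (t * exp x) * (t * exp x) powr (p - 1)"
      using t powr_mult_base[of "t * exp x" "p - 1"] by simp
    ultimately show ?thesis
      using t by (simp add: f_def exp_diff)
  qed
  ultimately have *: "(\<lambda>x. t powr p * exp (p * x - t * exp x)) absolutely_integrable_on UNIV"
       "integral UNIV (\<lambda>x. t powr p * exp (p * x - t * exp x)) = Gamma p"
    by simp_all
  have "integrable lebesgue (\<lambda>x. t powr p * exp (p * x - t * exp x))"
    using *(1) by (simp add: set_integrable_def)
  hence i: "integrable lborel (\<lambda>x. t powr p * exp (p * x - t * exp x))"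
    by (simp add: integrable_completion)
  have "integral\<^sup>L lborel (\<lambda>x. t powr p * exp (p * x - t * exp x)) = Gamma p"
    using *(2) integral_lborel[OF i] by simp
  with i have "has_bochner_integral lborel (\<lambda>x. t powr p * exp (p * x - t * exp x)) (Gamma p)"
    by (simp add: has_bochner_integral_iff)
  from has_bochner_integral_mult_right[OF this, of "t powr (-p)"]
  show ?thesis using t by (simp add: powr_minus field_simps)
qed

lemma integrable_exp_exp_scaled:
  fixes p c \<nu> :: real
  assumes "p > 0" "c > 0" "\<nu> > 0"
  shows "integrable lborel (\<lambda>x. exp (p * x - c * exp (\<nu> * x)))"
proof -
  have "integrable lborel (\<lambda>x. exp ((p / \<nu>) * x - c * exp x))"
    using has_bochner_integral_Gamma_exp[of "p / \<nu>" c] assms by (auto simp: has_bochner_integral_iff)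
  from lborel_integrable_real_affine[OF this, of \<nu> 0] show ?thesis using assms by simp
qed

lemma exp_scaled_le_linear:
  fixes y t \<nu> :: real
  assumes "t > 0" "0 < \<nu>" "\<nu> < 1"
  shows "\<exists>C. \<forall>x. y * exp (\<nu> * x) \<le> t * exp x + C"
proof (cases "y \<le> 0")
  case True
  have "y * exp (\<nu> * x) \<le> 0" "t * exp x \<ge> 0" for x
    using True assms by (simp_all add: mult_nonpos_nonneg)
  thus ?thesis by (intro exI[of _ 0]) (metis add.right_neutral order_trans)
next
  case False
  \<comment> \<open>The point where \<open>y * exp (\<nu> * x)\<close> and \<open>t * exp x\<close>
    cross. To its right the second dominates; to its left the first is at most its value at
    \<open>x0\<close>, which serves as the constant.\<close>
  define x0 where "x0 = ln (y / t) / (1 - \<nu>)"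
  have "y * exp (\<nu> * x) \<le> t * exp x + y * exp (\<nu> * x0)" for x
  proof (cases "x \<ge> x0")
    case True
    hence "ln (y / t) \<le> (1 - \<nu>) * x" using assms by (simp add: x0_def field_simps)
    hence "exp (ln (y / t)) \<le> exp ((1 - \<nu>) * x)" by simp
    hence "y / t \<le> exp x / exp (\<nu> * x)" using False assms by (simp add: algebra_simps exp_diff)
    hence "y * exp (\<nu> * x) \<le> t * exp x" using assms by (simp add: field_simps)
    moreover have "y * exp (\<nu> * x0) \<ge> 0" using False by simp
    ultimately show ?thesis by linarith
  next
    case False': False
    hence "y * exp (\<nu> * x) \<le> y * exp (\<nu> * x0)" using False assms by simp
    moreover have "t * exp x \<ge> 0" using assms by simp
    ultimately show ?thesis by linarith
  qed
  thus ?thesis by blast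
qed

lemma integrable_exp_exp_perturbed:
  fixes p t y \<nu> :: real
  assumes "p > 0" "t > 0" "0 < \<nu>" "\<nu> < 1"
  shows "integrable lborel (\<lambda>x. exp (p * x - t * exp x + y * exp (\<nu> * x)))"
proof -
  \<comment> \<open>Half of \<open>t * exp x\<close> absorbs the perturbation; the other half keeps
    a convergent Gamma integral.\<close>
  obtain C where C: "\<And>x. y * exp (\<nu> * x) \<le> t / 2 * exp x + C"
    using exp_scaled_le_linear[of "t / 2" \<nu> y] assms by auto
  have "integrable lborel (\<lambda>x. exp C * exp (p * x - (t / 2) * exp x))"
    using has_bochner_integral_Gamma_exp[of p "t / 2"] assms by (auto simp: has_bochner_integral_iff)
  thus ?thesis
  proof (rule Bochner_Integration.integrable_bound)
    have "p * x - t * exp x + y * exp (\<nu> * x) \<le> C + (p * x - (t / 2) * exp x)" for x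
      using C[of x] by simp
    hence "exp (p * x - t * exp x + y * exp (\<nu> * x)) \<le> exp C * exp (p * x - (t / 2) * exp x)" for x
      by (simp flip: exp_add)
    thus "AE x in lborel. norm (exp (p * x - t * exp x + y * exp (\<nu> * x)))
            \<le> norm (exp C * exp (p * x - t / 2 * exp x))" by simp
  qed measurable
qed

lemma rGamma_reflection_real: "rGamma z * rGamma (1 - z :: real) = sin (pi * z) / pi"
proof -
  have "complex_of_real (rGamma z * rGamma (1 - z)) = complex_of_real (sin (pi * z) / pi)"
  proof -
    have "rGamma (1 - complex_of_real z) = complex_of_real (rGamma (1 - z))"
      using rGamma_complex_of_real[of "1 - z"] by simp
    moreover have "sin (of_real pi * complex_of_real z) = complex_of_real (sin (pi * z))"
      using sin_of_real[of "pi * z", where 'a = complex] by simp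
    ultimately show ?thesis
      using rGamma_reflection_complex[of "complex_of_real z"] by (simp add: rGamma_complex_of_real)
  qed
  thus ?thesis by (simp only: of_real_eq_iff)
qed

text \<open>The poles of \<open>Gamma z\<close> are included: there \<open>Gamma z = 0\<close> by
  convention, so the left side is 0, in agreement with the sine. Hence Wright coefficients at such
  points get their correct value 0.\<close>

lemma inverse_Gamma_reflection_real:
  fixes z :: real
  assumes "z < 1"
  shows "inverse (Gamma z) = Gamma (1 - z) * sin (pi * z) / pi"
proof -
  have "Gamma (1 - z) > 0" using assms by (intro Gamma_real_pos) simp
  moreover have "inverse (Gamma z) * inverse (Gamma (1 - z)) = sin (pi * z) / pi"
    using rGamma_reflection_real[of z] by (simp add: Gamma_def)
  ultimately have "inverse (Gamma z) = sin (pi * z) / pi * Gamma (1 - z)"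
    by (metis less_irrefl mult.assoc left_inverse mult.right_neutral)
  thus ?thesis by simp
qed

subsection \<open>Integral representation of Wright functions\<close>

text \<open>The half-line variable is \<open>r = exp x\<close>, so that the integrals range over all of the real
  line and the contour below becomes a rectangle.\<close>

definition wright_kernel :: "real \<Rightarrow> real \<Rightarrow> real \<Rightarrow> real \<Rightarrow> real" where
  "wright_kernel \<nu> b y x =
     exp (- y * cos (pi * \<nu>) * exp (\<nu> * x)) * sin (pi * b + y * sin (pi * \<nu>) * exp (\<nu> * x))"

text \<open>The power of \<open>t\<close> is chosen so that \<open>b\<close> enters the Laplace
  transform only through the factor \<open>s powr (- b)\<close>. Abel integration of order
  \<open>a\<close> then takes \<open>b = 0\<close> to \<open>b = 1 - a\<close>.\<close>

definition wright_profile :: "real \<Rightarrow> real \<Rightarrow> real \<Rightarrow> real \<Rightarrow> real" where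
  "wright_profile \<nu> b y t = t powr (b - 1) * wright (- (y / t powr \<nu>)) (- \<nu>) b"

lemma wright_kernel_measurable [measurable]: "wright_kernel \<nu> b y \<in> borel_measurable borel"
  unfolding wright_kernel_def by measurable

lemma Im_of_real_mult: "Im (of_real r * z) = r * Im z"
  by simp

text \<open>The complex form has two uses: its exponential expands into the power series of the
  kernel, and it is the shape in which the lower edge of the contour delivers the kernel.\<close>

lemma wright_kernel_altdef:
  "wright_kernel \<nu> b y x = Im (cis (pi * b) * exp (of_real (- y * exp (\<nu> * x)) * cis (- (pi * \<nu>))))"
proof -
  have "exp (of_real (- y * exp (\<nu> * x)) * cis (- (pi * \<nu>))) =
        of_real (exp (- y * cos (pi * \<nu>) * exp (\<nu> * x))) * cis (y * sin (pi * \<nu>) * exp (\<nu> * x))"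
    by (subst exp_eq_polar) (simp add: algebra_simps)
  moreover have "cis (pi * b) * (of_real r * cis u) = of_real r * cis (pi * b + u)" for r u
    using cis_mult[of "pi * b" u] by simp
  ultimately show ?thesis
    by (simp only: wright_kernel_def) simp
qed

text \<open>The phase of the n-th term is \<open>pi * (b - n * \<nu>)\<close>, whose sine is the one
  that the reflection formula pairs with \<open>Gamma (1 - b + n * \<nu>)\<close>.\<close>

lemma wright_kernel_sums:
  "(\<lambda>n. (- y * exp (\<nu> * x)) ^ n / fact n * sin (pi * (b - real n * \<nu>))) sums wright_kernel \<nu> b y x"
proof -
  define Y where "Y = - y * exp (\<nu> * x)"
  have "(\<lambda>n. Im (cis (pi * b) * ((of_real Y * cis (- (pi * \<nu>))) ^ n /\<^sub>R fact n)))
          sums Im (cis (pi * b) * exp (of_real Y * cis (- (pi * \<nu>))))"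
    by (intro sums_Im sums_mult exp_converges)
  moreover have "Im (cis (pi * b) * ((of_real Y * cis (- (pi * \<nu>))) ^ n /\<^sub>R fact n)) =
                 Y ^ n / fact n * sin (pi * (b - real n * \<nu>))" for n
  proof -
    have "cis (pi * b) * ((of_real Y * cis (- (pi * \<nu>))) ^ n /\<^sub>R fact n) =
          of_real (Y ^ n / fact n) * (cis (pi * b) * cis (- (pi * \<nu>)) ^ n)"
      by (simp add: power_mult_distrib scaleR_conv_of_real field_simps)
    also have "cis (pi * b) * cis (- (pi * \<nu>)) ^ n = cis (pi * (b - real n * \<nu>))"
      by (simp only: Complex.DeMoivre cis_mult) (simp add: algebra_simps)
    finally show ?thesis by (simp only: Im_of_real_mult) simp
  qed
  ultimately show ?thesis by (simp add: wright_kernel_altdef Y_def)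
qed

text \<open>The bound is uniform in \<open>N\<close>, so it dominates the partial sums when series
  and integral are interchanged.\<close>

lemma norm_sum_exp_terms_le:
  fixes u :: real and c :: "nat \<Rightarrow> real"
  assumes "\<And>n. \<bar>c n\<bar> \<le> 1"
  shows "\<bar>\<Sum>n<N. u ^ n / fact n * c n\<bar> \<le> exp \<bar>u\<bar>"
proof -
  have "\<bar>\<Sum>n<N. u ^ n / fact n * c n\<bar> \<le> (\<Sum>n<N. \<bar>u ^ n / fact n * c n\<bar>)" by (rule sum_abs)
  also have "\<dots> \<le> (\<Sum>n<N. \<bar>u\<bar> ^ n /\<^sub>R fact n)"
  proof (rule sum_mono)
    fix n
    have "\<bar>u ^ n / fact n * c n\<bar> = \<bar>u\<bar> ^ n / fact n * \<bar>c n\<bar>"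
      by (simp add: abs_mult power_abs)
    also have "\<dots> \<le> \<bar>u\<bar> ^ n / fact n * 1" by (intro mult_left_mono assms) auto
    finally show "\<bar>u ^ n / fact n * c n\<bar> \<le> \<bar>u\<bar> ^ n /\<^sub>R fact n" by (simp add: field_simps)
  qed
  also have "\<dots> \<le> exp \<bar>u\<bar>"
    using exp_converges[of "\<bar>u\<bar>"] unfolding sums_iff
    by (metis (no_types, lifting) abs_ge_zero divideR_right fact_ge_zero inverse_nonnegative_iff_nonnegative
        scaleR_nonneg_nonneg sum_le_suminf finite_lessThan zero_le_power)
  finally show ?thesis .
qed

lemma has_bochner_integral_exp_power:
  assumes "0 < \<nu>" "b < 1" "t > 0"
  shows "has_bochner_integral lborel
           (\<lambda>x. exp ((1 - b) * x - t * exp x) * ((y * exp (\<nu> * x)) ^ n / fact n * c))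
           (t powr (b - 1) * ((y / t powr \<nu>) ^ n / fact n * (Gamma (1 - b + real n * \<nu>) * c)))"
proof -
  have "has_bochner_integral lborel
          (\<lambda>x. y ^ n / fact n * c * exp ((1 - b + real n * \<nu>) * x - t * exp x))
          (y ^ n / fact n * c * (Gamma (1 - b + real n * \<nu>) * t powr - (1 - b + real n * \<nu>)))"
    using assms by (intro has_bochner_integral_mult_right has_bochner_integral_Gamma_exp)
                   (auto intro: add_pos_nonneg)
  moreover have "t powr - (1 - b + real n * \<nu>) = t powr (b - 1) / (t powr \<nu>) ^ n"
    using assms by (simp add: powr_diff powr_powr powr_add powr_minus field_simps flip: powr_realpow)
  moreover have "exp ((1 - b + real n * \<nu>) * x - t * exp x) =
                 exp ((1 - b) * x - t * exp x) * exp (\<nu> * x) ^ n" for x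
    by (simp add: algebra_simps flip: exp_of_nat_mult exp_add)
  ultimately show ?thesis
    by (simp add: power_mult_distrib power_divide algebra_simps)
qed

text \<open>Avoids asymptotics of Gamma: each term is the integral of a nonnegative function, and
  all partial sums are bounded by the integral of one exponential, which is finite because
  \<open>\<nu> < 1\<close>.\<close>

lemma summable_Gamma_power:
  assumes "0 < \<nu>" "\<nu> < 1" "b < 1"
  shows "summable (\<lambda>n. \<bar>z\<bar> ^ n / fact n * Gamma (1 - b + real n * \<nu>))"
proof -
  let ?f = "\<lambda>n x. exp ((1 - b) * x - 1 * exp x) * ((\<bar>z\<bar> * exp (\<nu> * x)) ^ n / fact n * 1)"
  let ?g = "\<lambda>x. exp ((1 - b) * x - 1 * exp x + \<bar>z\<bar> * exp (\<nu> * x))"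
  have f: "has_bochner_integral lborel (?f n) (\<bar>z\<bar> ^ n / fact n * Gamma (1 - b + real n * \<nu>))" for n
    using has_bochner_integral_exp_power[of \<nu> b 1 "\<bar>z\<bar>" n 1] assms by simp
  have g: "integrable lborel ?g"
    using assms by (intro integrable_exp_exp_perturbed) auto
  show ?thesis
  proof (rule summableI_nonneg_bounded)
    fix n show "0 \<le> \<bar>z\<bar> ^ n / fact n * Gamma (1 - b + real n * \<nu>)"
      using assms by (intro mult_nonneg_nonneg order.strict_implies_order[OF Gamma_real_pos])
                     (auto intro: add_pos_nonneg)
  next
    fix N
    have "(\<Sum>n<N. \<bar>z\<bar> ^ n / fact n * Gamma (1 - b + real n * \<nu>)) =
          integral\<^sup>L lborel (\<lambda>x. \<Sum>n<N. ?f n x)"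
      using has_bochner_integral_sum[OF f, where I = "{..<N}"] by (simp add: has_bochner_integral_iff)
    also have "\<dots> \<le> integral\<^sup>L lborel ?g"
    proof (rule integral_mono)
      show "integrable lborel (\<lambda>x. \<Sum>n<N. ?f n x)"
        using has_bochner_integral_sum[OF f, where I = "{..<N}"] by (simp add: has_bochner_integral_iff)
      fix x
      have "(\<Sum>n<N. ?f n x) = exp ((1 - b) * x - 1 * exp x) * (\<Sum>n<N. (\<bar>z\<bar> * exp (\<nu> * x)) ^ n / fact n * 1)"
        by (simp add: sum_distrib_left)
      also have "\<dots> \<le> exp ((1 - b) * x - 1 * exp x) * exp \<bar>\<bar>z\<bar> * exp (\<nu> * x)\<bar>"
        by (intro mult_left_mono order.trans[OF abs_ge_self norm_sum_exp_terms_le]) auto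
      also have "\<dots> = ?g x" by (simp flip: exp_add)
      finally show "(\<Sum>n<N. ?f n x) \<le> ?g x" .
    qed (fact g)
    finally show "(\<Sum>n<N. \<bar>z\<bar> ^ n / fact n * Gamma (1 - b + real n * \<nu>)) \<le> integral\<^sup>L lborel ?g" .
  qed
qed

text \<open>Integrating the kernel series term by term produces
  \<open>Gamma (1 - b + n * \<nu>) * sin (pi * (b - n * \<nu>)) / pi\<close>, which is
  \<open>1 / Gamma (b - n * \<nu>)\<close> by reflection. With \<open>b < 1\<close> every Gamma
  argument is positive.\<close>

lemma wright_integral_representation:
  assumes "0 < \<nu>" "\<nu> < 1" "b < 1" "t > 0"
  shows "has_bochner_integral lborel
           (\<lambda>x. exp ((1 - b) * x - t * exp x) * wright_kernel \<nu> b y x / pi) (wright_profile \<nu> b y t)"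
proof -
  let ?f = "\<lambda>n x. exp ((1 - b) * x - t * exp x) *
                    ((- y * exp (\<nu> * x)) ^ n / fact n * (sin (pi * (b - real n * \<nu>)) / pi))"
  let ?F = "\<lambda>x. exp ((1 - b) * x - t * exp x) * wright_kernel \<nu> b y x / pi"
  let ?g = "\<lambda>x. exp ((1 - b) * x - t * exp x + \<bar>y\<bar> * exp (\<nu> * x))"
  define A where "A = (\<lambda>n. (- (y / t powr \<nu>)) ^ n / (fact n * Gamma (real n * (- \<nu>) + b)))"
  have f: "has_bochner_integral lborel (?f n) (t powr (b - 1) * A n)" for n
  proof -
    have *: "Gamma (1 - b + real n * \<nu>) * (sin (pi * (b - real n * \<nu>)) / pi) =
             inverse (Gamma (real n * (- \<nu>) + b))"
      using inverse_Gamma_reflection_real[of "b - real n * \<nu>"] assms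
      by (simp add: algebra_simps add_strict_increasing2 add.commute less_le_trans)
    show ?thesis
      using has_bochner_integral_exp_power[of \<nu> b t "- y" n "sin (pi * (b - real n * \<nu>)) / pi"] assms
      by (simp only: * A_def) (simp add: field_simps)
  qed
  have g: "integrable lborel ?g"
    using assms by (intro integrable_exp_exp_perturbed) auto
  have lim: "(\<lambda>N. \<Sum>n<N. ?f n x) \<longlonglongrightarrow> ?F x" for x
  proof -
    have "(\<lambda>n. exp ((1 - b) * x - t * exp x) / pi *
              ((- y * exp (\<nu> * x)) ^ n / fact n * sin (pi * (b - real n * \<nu>))))
            sums (exp ((1 - b) * x - t * exp x) / pi * wright_kernel \<nu> b y x)"
      by (intro sums_mult wright_kernel_sums)
    thus ?thesis by (simp add: sums_def field_simps)
  qed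
  have bound: "norm (\<Sum>n<N. ?f n x) \<le> ?g x" for N x
  proof -
    have "(\<Sum>n<N. ?f n x) = exp ((1 - b) * x - t * exp x) *
            (\<Sum>n<N. (- y * exp (\<nu> * x)) ^ n / fact n * (sin (pi * (b - real n * \<nu>)) / pi))"
      by (simp add: sum_distrib_left)
    hence "norm (\<Sum>n<N. ?f n x) = exp ((1 - b) * x - t * exp x) *
            \<bar>\<Sum>n<N. (- y * exp (\<nu> * x)) ^ n / fact n * (sin (pi * (b - real n * \<nu>)) / pi)\<bar>"
      by (simp add: abs_mult)
    also have "\<dots> \<le> exp ((1 - b) * x - t * exp x) * exp \<bar>- y * exp (\<nu> * x)\<bar>"
    proof (intro mult_left_mono norm_sum_exp_terms_le)
      fix n
      have "\<bar>sin (pi * (b - real n * \<nu>))\<bar> \<le> 1" "1 \<le> pi" using pi_gt3 by auto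
      hence "\<bar>sin (pi * (b - real n * \<nu>))\<bar> \<le> pi" by linarith
      thus "\<bar>sin (pi * (b - real n * \<nu>)) / pi\<bar> \<le> 1" by simp
    qed auto
    also have "\<dots> = ?g x" by (simp add: abs_mult flip: exp_add)
    finally show ?thesis .
  qed
  have sumf: "has_bochner_integral lborel (\<lambda>x. \<Sum>n<N. ?f n x) (\<Sum>n<N. t powr (b - 1) * A n)" for N
    by (rule has_bochner_integral_sum[OF f])
  have intF: "integrable lborel ?F"
    by (rule integrable_dominated_convergence[where w = ?g and s = "\<lambda>N x. \<Sum>n<N. ?f n x"])
       (use g lim bound in auto)
  have "(\<lambda>N. integral\<^sup>L lborel (\<lambda>x. \<Sum>n<N. ?f n x)) \<longlonglongrightarrow> integral\<^sup>L lborel ?F"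
    by (rule integral_dominated_convergence[where w = ?g])
       (use g lim bound in auto)
  moreover have "integral\<^sup>L lborel (\<lambda>x. \<Sum>n<N. ?f n x) = (\<Sum>n<N. t powr (b - 1) * A n)" for N
    using sumf[of N] by (simp add: has_bochner_integral_iff)
  ultimately have "(\<lambda>n. t powr (b - 1) * A n) sums integral\<^sup>L lborel ?F"
    by (simp add: sums_def)
  hence "(\<lambda>n. t powr (b - 1) * A n / t powr (b - 1)) sums (integral\<^sup>L lborel ?F / t powr (b - 1))"
    by (rule sums_divide)
  moreover have "t powr (b - 1) * A n / t powr (b - 1) = A n" for n
    using assms by simp
  ultimately have "A sums (integral\<^sup>L lborel ?F / t powr (b - 1))"
    by (simp only:)
  hence "wright (- (y / t powr \<nu>)) (- \<nu>) b = integral\<^sup>L lborel ?F / t powr (b - 1)"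
    unfolding wright_def A_def by (simp add: sums_iff)
  hence "wright_profile \<nu> b y t = integral\<^sup>L lborel ?F"
    using assms by (simp add: wright_profile_def)
  with intF show ?thesis by (simp add: has_bochner_integral_iff)
qed

subsection \<open>The contour integral\<close>

lemma contour_integral_linepath_same_Im:
  assumes "a < b"
  shows "contour_integral (linepath (Complex a v) (Complex b v)) f = integral {a..b} (\<lambda>x. f (Complex x v))"
proof -
  have "linepath (Complex a v) (Complex b v) =
        (+) (\<i> * of_real v) \<circ> linepath (of_real a) (of_real b)"
    by (auto simp: linepath_def fun_eq_iff complex_eq_iff algebra_simps)
  moreover have "Complex x v = of_real x + \<i> * of_real v" for x
    by (simp add: complex_eq_iff)
  ultimately show ?thesis
    using assms by (simp add: contour_integral_translate contour_integral_linepath_Reals_eq)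
qed

lemma abs_wright_kernel_le:
  "\<bar>wright_kernel \<nu> b y x\<bar> \<le> exp (- (y * cos (pi * \<nu>)) * exp (\<nu> * x))"
  by (simp add: wright_kernel_def abs_mult mult_left_le)

text \<open>Makes the kernel decay doubly exponentially as \<open>x\<close> grows, so that it is
  integrable even without the factor \<open>exp (- t * exp x)\<close>.\<close>

lemma cos_pi_mult_pos: "0 < \<nu> \<Longrightarrow> \<nu> < 1 / 2 \<Longrightarrow> cos (pi * \<nu>) > 0"
  by (intro cos_gt_zero) (auto simp: field_simps)

lemma integrable_exp_wright_kernel:
  assumes "0 < \<nu>" "\<nu> < 1 / 2" "b < 1" "y > 0"
  shows "integrable lborel (\<lambda>x. exp ((1 - b) * x) * wright_kernel \<nu> b y x)"
proof (rule Bochner_Integration.integrable_bound)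
  show "integrable lborel (\<lambda>x. exp ((1 - b) * x - (y * cos (pi * \<nu>)) * exp (\<nu> * x)))"
    using assms cos_pi_mult_pos[of \<nu>] by (intro integrable_exp_exp_scaled) auto
  have "norm (exp ((1 - b) * x) * wright_kernel \<nu> b y x) \<le>
        norm (exp ((1 - b) * x - (y * cos (pi * \<nu>)) * exp (\<nu> * x)))" for x
  proof -
    have "norm (exp ((1 - b) * x) * wright_kernel \<nu> b y x) =
          exp ((1 - b) * x) * \<bar>wright_kernel \<nu> b y x\<bar>" by (simp add: abs_mult)
    also have "\<dots> \<le> exp ((1 - b) * x) * exp (- (y * cos (pi * \<nu>)) * exp (\<nu> * x))"
      by (intro mult_left_mono abs_wright_kernel_le) auto
    finally show ?thesis by (simp flip: exp_add)
  qed
  thus "AE x in lborel. norm (exp ((1 - b) * x) * wright_kernel \<nu> b y x) \<le>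
          norm (exp ((1 - b) * x - (y * cos (pi * \<nu>)) * exp (\<nu> * x)))" by simp
qed measurable

text \<open>The denominator arises as the Laplace transform of \<open>exp (- t * exp x)\<close> in
  \<open>t\<close>; the resulting Stieltjes integral is the one evaluated by residues.\<close>

lemma integrable_exp_wright_kernel_Stieltjes:
  assumes "0 < \<nu>" "\<nu> < 1 / 2" "b < 1" "y > 0" "s > 0"
  shows "integrable lborel (\<lambda>x. exp ((1 - b) * x) * wright_kernel \<nu> b y x / (exp x + s))"
proof (rule Bochner_Integration.integrable_bound)
  show "integrable lborel (\<lambda>x. exp ((1 - b) * x) * wright_kernel \<nu> b y x / s)"
    using integrable_exp_wright_kernel[OF assms(1-4)] by simp
  have "norm (exp ((1 - b) * x) * wright_kernel \<nu> b y x / (exp x + s)) \<le>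
        norm (exp ((1 - b) * x) * wright_kernel \<nu> b y x / s)" for x
    unfolding norm_divide using assms by (intro divide_left_mono) (auto intro!: mult_pos_pos add_pos_pos)
  thus "AE x in lborel. norm (exp ((1 - b) * x) * wright_kernel \<nu> b y x / (exp x + s)) \<le>
          norm (exp ((1 - b) * x) * wright_kernel \<nu> b y x / s)" by simp
qed (use assms in measurable)

text \<open>In the variable \<open>w = ln \<zeta>\<close> the keyhole contour around the negative axis is the boundary of a
  rectangle, the two sides of the cut are its horizontal edges, and the only singularity left is
  the simple pole at \<open>ln s\<close>.\<close>

definition wright_strip_fun :: "real \<Rightarrow> real \<Rightarrow> real \<Rightarrow> real \<Rightarrow> complex \<Rightarrow> complex" where
  "wright_strip_fun \<nu> b y s w =
     exp (of_real (1 - b) * w) * exp (- of_real y * exp (of_real \<nu> * w)) / (exp w - of_real s)"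

text \<open>By this symmetry the upper edge contributes the conjugate of the lower one, so only
  imaginary parts survive in the difference.\<close>

lemma wright_strip_fun_cnj: "wright_strip_fun \<nu> b y s (cnj w) = cnj (wright_strip_fun \<nu> b y s w)"
  by (simp add: wright_strip_fun_def exp_cnj)

lemma wright_strip_fun_lower_edge:
  "Im (wright_strip_fun \<nu> b y s (Complex x (- pi))) =
     exp ((1 - b) * x) * wright_kernel \<nu> b y x / (exp x + s)"
proof -
  have *: "Complex x v = of_real x + \<i> * of_real v" for v by (simp add: complex_eq_iff)
  have e: "exp (of_real c * Complex x (- pi)) = of_real (exp (c * x)) * cis (- (pi * c))" for c
    unfolding * by (subst exp_eq_polar) (simp add: algebra_simps)
  \<comment> \<open>This minus sign cancels the one from \<open>exp w - s = - (exp x + s)\<close> on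
    the edge.\<close>
  have "cis (- (pi * (1 - b))) = - cis (pi * b)"
    by (simp add: complex_eq_iff algebra_simps sin_diff cos_diff)
  hence 1: "exp (of_real (1 - b) * Complex x (- pi)) = - of_real (exp ((1 - b) * x)) * cis (pi * b)"
    by (simp only: e) simp
  have 2: "exp (Complex x (- pi)) - of_real s = - of_real (exp x + s)"
    using e[of 1] by (simp add: complex_eq_iff)
  have "wright_strip_fun \<nu> b y s (Complex x (- pi)) =
        of_real (exp ((1 - b) * x) / (exp x + s)) *
          (cis (pi * b) * exp (of_real (- y * exp (\<nu> * x)) * cis (- (pi * \<nu>))))"
    unfolding wright_strip_fun_def 1 2 e[of \<nu>] by (simp add: mult_ac del: of_real_add)
  thus ?thesis by (simp only: Im_of_real_mult wright_kernel_altdef) simp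
qed

lemma abs_less_two_pi: "- pi \<le> v \<Longrightarrow> v \<le> pi \<Longrightarrow> \<bar>v\<bar> < 2 * pi"
  using pi_gt_zero by linarith

lemma wright_strip_fun_rectpath:
  fixes \<nu> b y s R :: real
  assumes "s > 0" "R > \<bar>ln s\<bar>"
  defines "P \<equiv> wright_strip_fun \<nu> b y s"
  shows "contour_integral (rectpath (Complex (- R) (- pi)) (Complex R pi)) P =
           2 * pi * \<i> * of_real (s powr (- b) * exp (- y * s powr \<nu>))" (is ?th1)
    and "\<And>A. A \<subseteq> {w. \<bar>Im w\<bar> < 2 * pi} - {of_real (ln s)} \<Longrightarrow> continuous_on A P"
proof -
  \<comment> \<open>The half-width \<open>2 * pi\<close> leaves room for the closed rectangle of
    half-height \<open>pi\<close>, while every zero \<open>ln s + 2 * pi * n * i\<close> of the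
    denominator with \<open>n\<close> nonzero stays outside.\<close>
  define S where "S = {w. \<bar>Im w\<bar> < 2 * pi}"
  define w0 where "w0 = complex_of_real (ln s)"
  define f where "f = (\<lambda>w::complex. exp (of_real (1 - b) * w) * exp (- of_real y * exp (of_real \<nu> * w)))"
  define g where "g = (\<lambda>w. exp w - complex_of_real s)"
  have P: "P = (\<lambda>w. f w / g w)" by (simp add: P_def wright_strip_fun_def f_def g_def fun_eq_iff)
  have S_alt: "S = {w. Im w < 2 * pi} \<inter> {w. Im w > - 2 * pi}" by (auto simp: S_def)
  have S: "open S" "connected S"
    unfolding S_alt
    by (auto intro!: open_Int open_halfspace_Im_lt open_halfspace_Im_gt
        convex_connected convex_Int convex_halfspace_Im_lt convex_halfspace_Im_gt)
  have w0: "w0 \<in> S" by (simp add: S_def w0_def)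
  have expw0: "exp w0 = of_real s"
    using assms by (simp add: w0_def exp_of_real)
  have nz: "g w \<noteq> 0" if w: "w \<in> S - {w0}" for w
  proof
    assume "g w = 0"
    hence "exp w = exp w0" by (simp add: g_def expw0)
    then obtain n :: int where n: "w = w0 + of_int (2 * n) * pi * \<i>"
      using exp_eq by (metis (no_types, lifting) of_int_mult of_int_numeral mult.assoc of_real_mult of_real_numeral of_real_of_int_eq)
    hence "\<bar>2 * real_of_int n * pi\<bar> < 2 * pi" using w by (simp add: S_def w0_def)
    hence "\<bar>real_of_int n\<bar> < 1" by (simp add: abs_mult)
    hence "n = 0" by linarith
    thus False using n w by simp
  qed
  have holf: "f holomorphic_on A" and holg: "g holomorphic_on A" for A
    unfolding f_def g_def by (intro holomorphic_intros)+
  have holP: "P holomorphic_on S - {w0}"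
    unfolding P using nz by (intro holomorphic_on_divide holf holg) auto
  show "continuous_on A P" if "A \<subseteq> {w. \<bar>Im w\<bar> < 2 * pi} - {of_real (ln s)}" for A
    using holomorphic_on_imp_continuous_on[OF holP] that continuous_on_subset
    by (auto simp: S_def w0_def)
  \<comment> \<open>At the pole the denominator has derivative \<open>exp w0 = s\<close>, which
    lowers the power \<open>s powr (1 - b)\<close> of \<open>f w0\<close> to
    \<open>s powr (- b)\<close>.\<close>
  have "residue P w0 = f w0 / of_real s"
    unfolding P
  proof (rule residue_simple_pole_deriv[OF holf holg S w0])
    show "(g has_field_derivative of_real s) (at w0)"
      unfolding g_def by (auto intro!: derivative_eq_intros simp: expw0)
  qed (use assms in \<open>auto simp: f_def g_def expw0\<close>)
  also have "\<dots> = of_real (s powr (- b) * exp (- y * s powr \<nu>))"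
  proof -
    have "exp (of_real c * w0) = of_real (s powr c)" for c
      using assms by (simp add: w0_def powr_def mult.commute flip: of_real_mult exp_of_real)
    hence "f w0 = of_real (s powr (1 - b)) * exp (- of_real y * of_real (s powr \<nu>))"
      unfolding f_def by presburger
    also have "\<dots> = of_real (s powr (1 - b) * exp (- y * s powr \<nu>))"
      by (simp flip: exp_of_real)
    finally have "f w0 = of_real (s powr (1 - b) * exp (- y * s powr \<nu>))" .
    thus ?thesis using assms by (simp add: powr_diff powr_minus field_simps)
  qed
  finally have res: "residue P w0 = of_real (s powr (- b) * exp (- y * s powr \<nu>))" .
  let ?a = "Complex (- R) (- pi)" and ?b = "Complex R pi"
  have R: "R > 0" using assms by simp
  have box: "w0 \<in> box ?a ?b" using assms by (auto simp: in_box_complex_iff w0_def)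
  have img: "path_image (rectpath ?a ?b) \<subseteq> S - {w0}"
    using box R
    by (subst path_image_rectpath_cbox_minus_box)
       (auto simp: S_def in_cbox_complex_iff intro: abs_less_two_pi)
  have "contour_integral (rectpath ?a ?b) P =
        2 * pi * \<i> * (\<Sum>p\<in>{w0}. winding_number (rectpath ?a ?b) p * residue P p)"
  proof (rule Residue_theorem[OF S _ holP])
    show "\<forall>z. z \<notin> S \<longrightarrow> winding_number (rectpath ?a ?b) z = 0"
      using R abs_less_two_pi
      by (auto intro!: winding_number_rectpath_outside simp: S_def in_cbox_complex_iff)
  qed (use img in auto)
  thus ?th1 using box by (simp add: winding_number_rectpath res)
qed

text \<open>For \<open>\<bar>v\<bar> \<le> pi\<close> the angle \<open>\<nu> * v\<close> has cosine
  at least \<open>cos (pi * \<nu>)\<close>, so the decay rate on the horizontal edges holds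
  throughout the strip. The denominator is bounded by the reverse triangle inequality.\<close>

lemma norm_wright_strip_fun_le:
  assumes "0 < \<nu>" "\<nu> < 1 / 2" "y > 0" "\<bar>v\<bar> \<le> pi" "exp x \<noteq> \<bar>s\<bar>"
  shows "norm (wright_strip_fun \<nu> b y s (Complex x v)) \<le>
           exp ((1 - b) * x) * exp (- y * cos (pi * \<nu>) * exp (\<nu> * x)) / \<bar>exp x - \<bar>s\<bar>\<bar>"
proof -
  have w: "Complex x v = of_real x + \<i> * of_real v" by (simp add: complex_eq_iff)
  have "\<nu> * \<bar>v\<bar> \<le> \<nu> * pi" "\<nu> * \<bar>v\<bar> \<le> 1 * pi" "\<nu> * pi \<le> 1 * pi"
    using assms by (intro mult_left_mono mult_mono; simp)+
  hence "cos (pi * \<nu>) \<le> cos (\<nu> * \<bar>v\<bar>)"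
    using assms by (subst cos_mono_le_eq) (auto simp: mult.commute)
  hence "cos (pi * \<nu>) \<le> cos (\<nu> * v)" by (simp add: abs_if split: if_splits)
  hence "exp (- y * cos (\<nu> * v) * exp (\<nu> * x)) \<le> exp (- y * cos (pi * \<nu>) * exp (\<nu> * x))"
    using assms by (simp add: mult_left_mono mult_right_mono)
  moreover have "norm (exp (- of_real y * exp (of_real \<nu> * Complex x v))) =
                 exp (- y * cos (\<nu> * v) * exp (\<nu> * x))"
    by (simp add: norm_exp_eq_Re Re_exp mult_ac)
  moreover have "\<bar>exp x - \<bar>s\<bar>\<bar> \<le> norm (exp (Complex x v) - of_real s)"
    using norm_triangle_ineq3[of "exp (Complex x v)" "of_real s"] by simp
  moreover have "norm (exp (of_real (1 - b) * Complex x v)) = exp ((1 - b) * x)"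
    by (simp add: norm_exp_eq_Re)
  moreover have "\<bar>exp x - \<bar>s\<bar>\<bar> > 0" using assms by simp
  ultimately show ?thesis
    unfolding wright_strip_fun_def norm_divide norm_mult by (intro frac_le mult_mono) auto
qed

text \<open>Traversed counterclockwise, the horizontal edges contribute \<open>I - cnj I\<close>,
  that is \<open>2 * \<i> * Im I\<close> for the lower edge integral \<open>I\<close>, and
  \<open>Im I\<close> is the truncated integral sought. The residue gives the value up to the two
  vertical edges.\<close>

lemma wright_kernel_Stieltjes:
  assumes "0 < \<nu>" "\<nu> < 1 / 2" "b < 1" "y > 0" "s > 0"
  shows "(LBINT x. exp ((1 - b) * x) * wright_kernel \<nu> b y x / (exp x + s)) =
           pi * (s powr (- b) * exp (- y * s powr \<nu>))"
proof -
  define P where "P = wright_strip_fun \<nu> b y s"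
  define q where "q = (\<lambda>x. exp ((1 - b) * x) * wright_kernel \<nu> b y x / (exp x + s))"
  define c where "c = y * cos (pi * \<nu>)"
  define B where "B = (\<lambda>x. exp ((1 - b) * x) * exp (- c * exp (\<nu> * x)) / \<bar>exp x - s\<bar>)"
  define K where "K = s powr (- b) * exp (- y * s powr \<nu>)"
  have c: "c > 0" using assms cos_pi_mult_pos[of \<nu>] by (simp add: c_def)
  have B: "norm (P (Complex x v)) \<le> B x" if "\<bar>v\<bar> \<le> pi" "\<bar>x\<bar> > \<bar>ln s\<bar>" for x v
  proof -
    have "exp x \<noteq> \<bar>s\<bar>"
    proof
      assume "exp x = \<bar>s\<bar>"
      hence "x = ln s" using assms by (metis abs_of_pos ln_exp)
      thus False using that by simp
    qed
    thus ?thesis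
      using norm_wright_strip_fun_le[of \<nu> y v x s b] assms that by (simp add: P_def B_def c_def)
  qed
  have B_nonneg: "B x \<ge> 0" for x by (simp add: B_def)
  have est: "\<bar>integral {-R..R} q - pi * K\<bar> \<le> pi * (B R + B (- R))" if R: "R > \<bar>ln s\<bar>" for R
  proof -
    let ?a1 = "Complex (- R) (- pi)" and ?a2 = "Complex R (- pi)"
    let ?a3 = "Complex R pi" and ?a4 = "Complex (- R) pi"
    let ?V1 = "contour_integral (linepath ?a2 ?a3) P" and ?V2 = "contour_integral (linepath ?a4 ?a1) P"
    have cont: "continuous_on A P" if "A \<subseteq> {w. \<bar>Im w\<bar> < 2 * pi} - {of_real (ln s)}" for A
      unfolding P_def by (rule wright_strip_fun_rectpath(2)[OF assms(5) R that])
    have seg: "closed_segment ?a1 ?a2 \<subseteq> {w. \<bar>Im w\<bar> < 2 * pi} - {of_real (ln s)}"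
              "closed_segment ?a4 ?a3 \<subseteq> {w. \<bar>Im w\<bar> < 2 * pi} - {of_real (ln s)}"
              "closed_segment ?a2 ?a3 \<subseteq> {w. \<bar>Im w\<bar> < 2 * pi} - {of_real (ln s)}"
              "closed_segment ?a4 ?a1 \<subseteq> {w. \<bar>Im w\<bar> < 2 * pi} - {of_real (ln s)}"
      using R
      by (auto simp: closed_segment_same_Im closed_segment_same_Re closed_segment_eq_real_ivl
            intro: abs_less_two_pi)
    note ci = contour_integrable_continuous_linepath[OF cont]
    have ci': "P contour_integrable_on linepath ?a1 ?a2" "P contour_integrable_on linepath ?a2 ?a3"
              "P contour_integrable_on linepath ?a3 ?a4" "P contour_integrable_on linepath ?a4 ?a1"
      using ci[OF seg(1)] ci[OF seg(2)] ci[OF seg(3)] ci[OF seg(4)]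
            ci[of ?a3 ?a4] seg(2) by (auto simp: closed_segment_commute)
    have "contour_integral (rectpath ?a1 ?a3) P =
          contour_integral (linepath ?a1 ?a2) P + ?V1 + contour_integral (linepath ?a3 ?a4) P + ?V2"
      using ci' by (simp add: rectpath_def Let_def contour_integrable_joinI)
    moreover have "contour_integral (rectpath ?a1 ?a3) P = 2 * pi * \<i> * of_real K"
      unfolding P_def K_def by (rule wright_strip_fun_rectpath(1)[OF assms(5) R])
    moreover have "contour_integral (linepath ?a1 ?a2) P = integral {-R..R} (\<lambda>x. P (Complex x (- pi)))"
      using R by (intro contour_integral_linepath_same_Im) auto
    moreover have "contour_integral (linepath ?a3 ?a4) P = - cnj (integral {-R..R} (\<lambda>x. P (Complex x (- pi))))"
    proof -
      have "contour_integral (linepath ?a3 ?a4) P = - contour_integral (linepath ?a4 ?a3) P"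
        using contour_integral_reversepath[of "linepath ?a4 ?a3" P] by simp
      also have "contour_integral (linepath ?a4 ?a3) P = integral {-R..R} (\<lambda>x. P (Complex x pi))"
        using R by (intro contour_integral_linepath_same_Im) auto
      also have "\<dots> = integral {-R..R} (\<lambda>x. cnj (P (Complex x (- pi))))"
        by (rule integral_cong) (simp add: P_def flip: wright_strip_fun_cnj, simp add: complex_cnj)
      also have "\<dots> = cnj (integral {-R..R} (\<lambda>x. P (Complex x (- pi))))"
        by (rule integral_cnj [symmetric])
      finally show ?thesis .
    qed
    ultimately have "2 * pi * \<i> * of_real K =
        integral {-R..R} (\<lambda>x. P (Complex x (- pi))) - cnj (integral {-R..R} (\<lambda>x. P (Complex x (- pi))))
        + (?V1 + ?V2)" by simp
    hence "Im (2 * pi * \<i> * of_real K) = Im (integral {-R..R} (\<lambda>x. P (Complex x (- pi)))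
             - cnj (integral {-R..R} (\<lambda>x. P (Complex x (- pi)))) + (?V1 + ?V2))" by (rule arg_cong)
    hence eq: "2 * pi * K = 2 * Im (integral {-R..R} (\<lambda>x. P (Complex x (- pi)))) + Im (?V1 + ?V2)"
      by simp
    have "(\<lambda>x. P (Complex x (- pi))) integrable_on {-R..R}"
    proof (rule integrable_continuous_real)
      show "continuous_on {-R..R} (\<lambda>x. P (Complex x (- pi)))"
        by (rule continuous_on_compose2[OF cont[OF seg(1)]])
           (auto intro!: continuous_intros simp: Complex_eq closed_segment_same_Im closed_segment_eq_real_ivl)
    qed
    hence "Im (integral {-R..R} (\<lambda>x. P (Complex x (- pi)))) = integral {-R..R} (\<lambda>x. Im (P (Complex x (- pi))))"
      by (rule integral_linear[OF _ bounded_linear_Im, unfolded o_def, symmetric])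
    also have "\<dots> = integral {-R..R} q"
      by (simp add: P_def q_def wright_strip_fun_lower_edge)
    finally have eq': "2 * (integral {-R..R} q - pi * K) = - Im (?V1 + ?V2)" using eq by simp
    have edge: "norm (P z) \<le> B x" if "\<bar>Im z\<bar> \<le> pi" "Re z = x" "x = R \<or> x = - R" for z x
      using B[of "Im z" x] that R by (cases z) auto
    have "norm ?V1 \<le> B R * norm (?a3 - ?a2)"
      using ci'(2) B_nonneg
      by (rule contour_integral_bound_linepath)
         (auto simp: closed_segment_same_Re closed_segment_eq_real_ivl complex_eq_iff
               split: if_splits intro!: edge)
    moreover have "norm ?V2 \<le> B (- R) * norm (?a1 - ?a4)"
      using ci'(4) B_nonneg
      by (rule contour_integral_bound_linepath)
         (auto simp: closed_segment_same_Re closed_segment_eq_real_ivl complex_eq_iff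
               split: if_splits intro!: edge)
    moreover have "norm (?a3 - ?a2) = 2 * pi" "norm (?a1 - ?a4) = 2 * pi"
      by (simp_all add: cmod_eq_Im)
    moreover have "\<bar>Im (?V1 + ?V2)\<bar> \<le> norm ?V1 + norm ?V2"
      by (rule order.trans[OF abs_Im_le_cmod norm_triangle_ineq])
    ultimately have "\<bar>2 * (integral {-R..R} q - pi * K)\<bar> \<le> B R * (2 * pi) + B (- R) * (2 * pi)"
      unfolding eq' abs_minus_cancel by (simp only:)
    thus ?thesis by (simp add: algebra_simps abs_mult)
  qed
  have int_q: "integrable lborel q"
    unfolding q_def by (rule integrable_exp_wright_kernel_Stieltjes[OF assms])
  have "(\<lambda>n. integral {-real n..real n} q - pi * K) \<longlonglongrightarrow> 0"
  proof (rule Lim_null_comparison)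
    \<comment> \<open>On the right the doubly exponential factor wins. On the left the denominator
      tends to \<open>s\<close>, and \<open>exp ((1 - b) * x)\<close> vanishes because
      \<open>b < 1\<close>.\<close>
    have "(B \<longlongrightarrow> 0) at_top" "((\<lambda>x. B (- x)) \<longlongrightarrow> 0) at_top"
      unfolding B_def using assms c by real_asymp+
    hence "((\<lambda>x. pi * (B x + B (- x))) \<longlongrightarrow> pi * (0 + 0)) at_top"
      by (intro tendsto_intros)
    thus "(\<lambda>n. pi * (B (real n) + B (- real n))) \<longlonglongrightarrow> 0"
      using filterlim_compose filterlim_real_sequentially by fastforce
    have "\<forall>\<^sub>F n in sequentially. real n > \<bar>ln s\<bar>"
      using filterlim_real_sequentially by (auto simp: filterlim_at_top_dense)
    thus "\<forall>\<^sub>F n in sequentially. norm (integral {-real n..real n} q - pi * K) \<le>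
            pi * (B (real n) + B (- real n))"
      by eventually_elim (use est in auto)
  qed
  hence "(\<lambda>n. integral {-real n..real n} q) \<longlonglongrightarrow> pi * K"
    by (rule LIM_zero_cancel)
  moreover have "(\<lambda>n. integral {-real n..real n} q) \<longlonglongrightarrow> integral\<^sup>L lborel q"
  proof -
    have "(\<lambda>n. LBINT x. indicator {-real n..real n} x *\<^sub>R q x) \<longlonglongrightarrow> integral\<^sup>L lborel q"
    proof (rule integral_dominated_convergence[where w = "\<lambda>x. norm (q x)"])
      have "(\<lambda>n. indicator {-real n..real n} x *\<^sub>R q x) \<longlonglongrightarrow> q x" for x
      proof (rule tendsto_eventually)
        have "\<forall>\<^sub>F n in sequentially. real n > \<bar>x\<bar>"
          using filterlim_real_sequentially by (auto simp: filterlim_at_top_dense)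
        thus "\<forall>\<^sub>F n in sequentially. indicator {-real n..real n} x *\<^sub>R q x = q x"
          by eventually_elim (auto simp: indicator_def)
      qed
      thus "AE x in lborel. (\<lambda>n. indicator {-real n..real n} x *\<^sub>R q x) \<longlonglongrightarrow> q x" by simp
    qed (use int_q in \<open>auto simp: indicator_def\<close>)
    moreover have "(LBINT x. indicator {-real n..real n} x *\<^sub>R q x) = integral {-real n..real n} q" for n
    proof -
      have "set_integrable lborel {-real n..real n} q"
        using integrable_mult_indicator[OF _ int_q] by (simp add: set_integrable_def)
      from set_borel_integral_eq_integral(2)[OF this] show ?thesis
        by (simp add: set_lebesgue_integral_def)
    qed
    ultimately show ?thesis by simp
  qed
  ultimately show ?thesis
    unfolding K_def q_def by (rule LIMSEQ_unique[rotated])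
qed

subsection \<open>Laplace transforms with nonnegative differences\<close>

text \<open>The step is 1 because replacing \<open>s\<close> by \<open>s + 1\<close> multiplies a
  Laplace integrand by \<open>exp (- t)\<close>; each difference thus inserts a factor
  \<open>1 - exp (- t)\<close>.\<close>

definition fdiff :: "(real \<Rightarrow> real) \<Rightarrow> real \<Rightarrow> real" where
  "fdiff F s = F s - F (s + 1)"

text \<open>Differences commute with derivatives, so the derivative of the m-th difference of
  \<open>F\<close> is minus the m-th difference of some \<open>G\<close> in the class, hence
  nonpositive by induction. The m-th difference is then nonincreasing and its next difference
  nonnegative.\<close>

lemma fdiff_power_nonneg:
  assumes nonneg: "\<And>F s. F \<in> C \<Longrightarrow> s > 0 \<Longrightarrow> F s \<ge> 0"
  assumes deriv: "\<And>F. F \<in> C \<Longrightarrow> \<exists>G\<in>C. \<forall>s>0. (F has_real_derivative - G s) (at s)"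
  assumes "F \<in> C" "s > 0"
  shows "(fdiff ^^ m) F s \<ge> 0"
proof -
  have deriv_pow: "(((fdiff ^^ m) F) has_real_derivative - (fdiff ^^ m) G s) (at s)"
    if "\<forall>s>0. (F has_real_derivative - G s) (at s)" "s > 0" for F G :: "real \<Rightarrow> real" and m s
    using that(2)
  proof (induction m arbitrary: s)
    case (Suc m)
    have "((\<lambda>x. (fdiff ^^ m) F (x + 1)) has_real_derivative - (fdiff ^^ m) G (s + 1)) (at s)"
      using Suc.IH[of "s + 1"] Suc.prems by (simp add: DERIV_shift)
    from DERIV_diff[OF Suc.IH[OF Suc.prems] this] show ?case
      by (simp add: fdiff_def[abs_def])
  qed (use that in auto)
  show ?thesis using assms(3,4)
  proof (induction m arbitrary: F s)
    case (Suc m)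
    obtain G where G: "G \<in> C" "\<forall>s>0. (F has_real_derivative - G s) (at s)"
      using deriv[OF Suc.prems(1)] by blast
    have "(fdiff ^^ m) F (s + 1) \<le> (fdiff ^^ m) F s"
    proof (rule DERIV_nonpos_imp_nonincreasing[of s "s + 1" "(fdiff ^^ m) F"])
      fix x assume "s \<le> x" "x \<le> s + 1"
      thus "\<exists>y. ((fdiff ^^ m) F has_real_derivative y) (at x) \<and> y \<le> 0"
        using deriv_pow[OF G(2), of x m] Suc.IH[OF G(1), of x] Suc.prems by auto
    qed simp
    thus ?case by (simp add: fdiff_def[of "(fdiff ^^ m) F"])
  qed (use nonneg in auto)
qed

text \<open>A cone of nonnegative functions closed under \<open>F \<mapsto> - F'\<close>; it stands in for complete
  monotonicity of \<open>exp (-y s\<^bsup>\<nu>\<^esup>)\<close>.\<close>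

inductive_set stretched_exp_cone :: "real \<Rightarrow> real \<Rightarrow> (real \<Rightarrow> real) set" for \<nu> y where
  base: "a \<ge> 0 \<Longrightarrow> (\<lambda>s. s powr (- a) * exp (- y * s powr \<nu>)) \<in> stretched_exp_cone \<nu> y"
| add: "F \<in> stretched_exp_cone \<nu> y \<Longrightarrow> G \<in> stretched_exp_cone \<nu> y \<Longrightarrow> (\<lambda>s. F s + G s) \<in> stretched_exp_cone \<nu> y"
| scale: "c \<ge> 0 \<Longrightarrow> F \<in> stretched_exp_cone \<nu> y \<Longrightarrow> (\<lambda>s. c * F s) \<in> stretched_exp_cone \<nu> y"

lemma stretched_exp_cone_nonneg: "F \<in> stretched_exp_cone \<nu> y \<Longrightarrow> F s \<ge> 0"
  by (induction rule: stretched_exp_cone.induct) auto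

text \<open>The product rule turns the exponent \<open>a\<close> into \<open>a + 1\<close> and
  \<open>a + (1 - \<nu>)\<close> with nonnegative coefficients; \<open>\<nu> < 1\<close> keeps the
  second exponent admissible.\<close>

lemma stretched_exp_cone_deriv:
  assumes "0 < \<nu>" "\<nu> < 1" "y > 0" "F \<in> stretched_exp_cone \<nu> y"
  shows "\<exists>G\<in>stretched_exp_cone \<nu> y. \<forall>s>0. (F has_real_derivative - G s) (at s)"
  using assms(4)
proof (induction rule: stretched_exp_cone.induct)
  case (base a)
  let ?G = "\<lambda>s. a * (s powr (- (a + 1)) * exp (- y * s powr \<nu>)) +
               (y * \<nu>) * (s powr (- (a + (1 - \<nu>))) * exp (- y * s powr \<nu>))"
  have G: "?G \<in> stretched_exp_cone \<nu> y"
    using assms base by (intro stretched_exp_cone.intros) auto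
  have "((\<lambda>s. s powr (- a) * exp (- y * s powr \<nu>)) has_real_derivative - ?G s) (at s)"
    if "s > 0" for s
  proof -
    have "((\<lambda>s. s powr (- a) * exp (- y * s powr \<nu>)) has_real_derivative
            (- a * s powr (- a - 1)) * exp (- y * s powr \<nu>) +
            (exp (- y * s powr \<nu>) * (- y * (\<nu> * s powr (\<nu> - 1)))) * s powr (- a)) (at s)"
      using that
      by (intro DERIV_mult DERIV_fun_exp DERIV_cmult has_real_derivative_powr)
    moreover have "s powr (- (a + (1 - \<nu>))) = s powr (- a) * s powr (\<nu> - 1)"
      using powr_add[of s "- a" "\<nu> - 1"] by (simp add: algebra_simps)
    moreover have "s powr (- (a + 1)) = s powr (- a - 1)" by (rule arg_cong) simp
    moreover have "(- a * Y) * E + (E * (- y * (\<nu> * Z))) * X =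
                   - (a * (Y * E) + (y * \<nu>) * (X * Z * E))" for X Y Z E
      by (simp add: algebra_simps)
    ultimately show ?thesis by metis
  qed
  thus ?case by (intro bexI[OF _ G] allI impI)
next
  case (add F G)
  then obtain F' G' where F': "F' \<in> stretched_exp_cone \<nu> y" "\<forall>s>0. (F has_real_derivative - F' s) (at s)"
     and G': "G' \<in> stretched_exp_cone \<nu> y" "\<forall>s>0. (G has_real_derivative - G' s) (at s)" by blast
  have "\<forall>s>0. ((\<lambda>s. F s + G s) has_real_derivative - (F' s + G' s)) (at s)"
    using F' G' by (auto intro!: derivative_eq_intros)
  thus ?case by (rule bexI[OF _ stretched_exp_cone.add[OF F'(1) G'(1)]])
next
  case (scale c F)
  then obtain F' where F': "F' \<in> stretched_exp_cone \<nu> y" "\<forall>s>0. (F has_real_derivative - F' s) (at s)"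
    by blast
  have "\<forall>s>0. ((\<lambda>s. c * F s) has_real_derivative - (c * F' s)) (at s)"
    using F' by (auto intro!: derivative_eq_intros)
  thus ?case by (rule bexI[OF _ stretched_exp_cone.scale[OF scale(1) F'(1)]])
qed

text \<open>With \<open>x = exp (- t)\<close> and \<open>s = k + 1\<close> the weight is
  \<open>x ^ k * (1 - x) ^ m\<close> times the \<open>x\<close> of the measure, a Bernstein
  polynomial up to its binomial coefficient.\<close>

definition laplace_integrand :: "(real \<Rightarrow> real) \<Rightarrow> real \<Rightarrow> nat \<Rightarrow> real \<Rightarrow> real" where
  "laplace_integrand h s m t = indicator {0<..} t * (exp (- s * t) * (1 - exp (- t)) ^ m * h t)"

definition laplace :: "(real \<Rightarrow> real) \<Rightarrow> real \<Rightarrow> real" where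
  "laplace h s = (LBINT t. laplace_integrand h s 0 t)"

definition laplace_transformable :: "(real \<Rightarrow> real) \<Rightarrow> bool" where
  "laplace_transformable h \<longleftrightarrow>
     continuous_on {0<..} h \<and> (\<forall>s>0. integrable lborel (laplace_integrand h s 0))"

lemma laplace_integrand_Suc:
  "laplace_integrand h s (Suc m) t = laplace_integrand h s m t - laplace_integrand h (s + 1) m t"
  by (simp add: laplace_integrand_def algebra_simps exp_diff exp_minus field_simps split: split_indicator)

lemma has_bochner_integral_laplace_integrand:
  assumes "laplace_transformable h" "s > 0"
  shows "has_bochner_integral lborel (laplace_integrand h s m) ((fdiff ^^ m) (laplace h) s)"
  using assms(2)
proof (induction m arbitrary: s)
  case 0
  thus ?case using assms(1)
    by (simp add: laplace_transformable_def laplace_def has_bochner_integral_iff)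
next
  case (Suc m)
  have "has_bochner_integral lborel (\<lambda>t. laplace_integrand h s m t - laplace_integrand h (s + 1) m t)
          ((fdiff ^^ m) (laplace h) s - (fdiff ^^ m) (laplace h) (s + 1))"
    using Suc by (intro has_bochner_integral_diff) auto
  thus ?case by (simp add: fdiff_def[of "(fdiff ^^ m) (laplace h)"] flip: laplace_integrand_Suc)
qed

text \<open>Nothing is assumed about \<open>p\<close> near 0 or at infinity, which correspond to
  \<open>x = 1\<close> and \<open>x = 0\<close>. The factor \<open>x * (1 - x)\<close> forces the
  limit 0 at both ends.\<close>

lemma continuous_on_damped_pullback:
  fixes p :: "real \<Rightarrow> real"
  assumes p: "continuous_on {0<..} p" "\<And>t. \<bar>p t\<bar> \<le> 1"
  defines "B \<equiv> (\<lambda>x. x * (1 - x) * p (- ln x))"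
  shows "continuous_on {0..1} B"
proof -
  have bound: "\<bar>B x\<bar> \<le> \<bar>x * (1 - x)\<bar>" for x
    unfolding B_def abs_mult[of _ "p _"] using p(2) by (intro mult_left_le) auto
  have "isCont B x" if "x \<in> {0<..<1}" for x
  proof -
    have "continuous_on {0<..<1} B"
      unfolding B_def
      by (intro continuous_intros continuous_on_compose2[OF p(1)]) auto
    thus ?thesis using that by (simp add: continuous_on_eq_continuous_at)
  qed
  moreover have "isCont B x" if "x = 0 \<or> x = 1" for x
  proof -
    have "((\<lambda>x. \<bar>x * (1 - x)\<bar>) \<longlongrightarrow> \<bar>x * (1 - x)\<bar>) (at x)"
      by (intro tendsto_intros)
    hence lim: "((\<lambda>x. \<bar>x * (1 - x)\<bar>) \<longlongrightarrow> 0) (at x)" using that by auto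
    have "(B \<longlongrightarrow> 0) (at x)"
      by (rule Lim_null_comparison[OF _ lim]) (use bound in auto)
    moreover have "B x = 0" using that by (auto simp: B_def)
    ultimately show ?thesis by (simp add: isCont_def)
  qed
  ultimately show ?thesis
    by (intro continuous_at_imp_continuous_on ballI) (metis atLeastAtMost_iff greaterThanLessThan_iff order_le_less)
qed

text \<open>With \<open>x = exp (-t)\<close> the hypothesis says that \<open>h\<close> integrates nonnegatively against
  Bernstein polynomials in \<open>x\<close>. These approximate the test function \<open>B\<close>, a damped version of
  the negative part of \<open>h\<close>, for which the integrand is nonpositive.\<close>

lemma laplace_fdiff_nonneg_imp_nonneg:
  assumes h: "laplace_transformable h"
  assumes mom: "\<And>m s. s > 0 \<Longrightarrow> (fdiff ^^ m) (laplace h) s \<ge> 0"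
  assumes "t > 0"
  shows "h t \<ge> 0"
proof -
  have cont: "continuous_on {0<..} h" using h by (simp add: laplace_transformable_def)
  \<comment> \<open>Continuous, bounded by 1, and positive exactly where \<open>h\<close> is
    negative.\<close>
  define p where "p = (\<lambda>t. max 0 (- h t) / (1 + \<bar>h t\<bar>))"
  define B where "B = (\<lambda>x. x * (1 - x) * p (- ln x))"
  have p_cont: "continuous_on {0<..} p"
    unfolding p_def by (intro continuous_intros cont) (auto simp: add_nonneg_eq_0_iff)
  have p_bound: "\<bar>p t\<bar> \<le> 1" for t by (auto simp: p_def field_simps)
  have B: "continuous_on {0..1} B"
    unfolding B_def by (rule continuous_on_damped_pullback[OF p_cont p_bound])
  have B_nonneg: "B x \<ge> 0" if "x \<in> {0..1}" for x
    using that by (auto simp: B_def p_def intro!: mult_nonneg_nonneg divide_nonneg_nonneg)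
  define g where "g = (\<lambda>t. laplace_integrand h 1 0 t)"
  have g: "integrable lborel g"
    unfolding g_def using has_bochner_integral_laplace_integrand[OF h, of 1 0]
    by (simp add: has_bochner_integral_iff)
  \<comment> \<open>Pointwise nonnegative, since \<open>B\<close> selects the set where
    \<open>h\<close> is negative. Once its integral is shown to be at most 0, it vanishes almost
    everywhere.\<close>
  define w where "w = (\<lambda>t. - (B (exp (- t)) * g t))"
  have w_eq: "w t = indicator {0<..} t * (exp (- t) * B (exp (- t)) * (- h t))" for t
    by (simp add: w_def g_def laplace_integrand_def)
  have hp: "p t * (- h t) = (max 0 (- h t))\<^sup>2 / (1 + \<bar>h t\<bar>)" for t
    by (auto simp: p_def max_def power2_eq_square)
  have w_eq': "w t = indicator {0<..} t * (exp (- t) * (exp (- t) * (1 - exp (- t))) * ((max 0 (- h t))\<^sup>2 / (1 + \<bar>h t\<bar>)))" for t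
    unfolding w_eq hp[symmetric] by (simp add: B_def)
  have w_nonneg: "w t \<ge> 0" for t
    unfolding w_eq' by (auto split: split_indicator intro!: mult_nonneg_nonneg divide_nonneg_nonneg)
  have meas_B: "(\<lambda>t. indicator {0<..} t * B (exp (- t))) \<in> borel_measurable borel"
  proof -
    have "continuous_on {0<..} (\<lambda>t. B (exp (- t)))"
      by (rule continuous_on_compose2[OF B]) (auto intro!: continuous_intros)
    thus ?thesis
      using borel_measurable_continuous_on_indicator[of "{0::real<..}" "\<lambda>t. B (exp (- t))"] by simp
  qed
  have Bg: "B (exp (- t)) * g t = (indicator {0<..} t * B (exp (- t))) * g t" for t
    by (simp add: g_def laplace_integrand_def split: split_indicator)
  have B_le: "\<bar>indicator {0<..} t * B (exp (- t))\<bar> \<le> 1" for t :: real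
  proof -
    have "\<bar>B (exp (- t))\<bar> \<le> 1 * 1 * 1" if "t > 0"
      unfolding B_def abs_mult using that p_bound by (intro mult_mono) auto
    thus ?thesis by (auto split: split_indicator)
  qed
  have w_int: "integrable lborel w"
  proof (rule Bochner_Integration.integrable_bound[OF g])
    show "w \<in> borel_measurable lborel"
      unfolding w_def Bg using meas_B g by measurable
    have "norm (w t) \<le> norm (g t)" for t
      using B_le[of t] unfolding w_def Bg norm_minus_cancel norm_mult
      by (simp add: mult_left_le_one_le abs_mult)
    thus "AE t in lborel. norm (w t) \<le> norm (g t)" by simp
  qed
  \<comment> \<open>Replacing \<open>B\<close> by a Bernstein polynomial \<open>P\<close> costs at
    most \<open>e\<close> in the supremum norm, and the integral of
    \<open>P (exp (- t)) * g t\<close> is nonnegative: the weights \<open>B (k / N)\<close> are, and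
    the moments are by \<open>mom\<close>.\<close>
  have "integral\<^sup>L lborel w \<le> e * integral\<^sup>L lborel (\<lambda>t. \<bar>g t\<bar>)" if e: "e > 0" for e
  proof -
    obtain N where N: "\<And>x. x \<in> {0..1} \<Longrightarrow> \<bar>B x - (\<Sum>k\<le>N. B (k / N) * Bernstein N k x)\<bar> < e"
      using Bernstein_Weierstrass[OF B e] by blast
    define P where "P = (\<lambda>x. \<Sum>k\<le>N. B (k / N) * Bernstein N k x)"
    \<comment> \<open>The shift to \<open>k + 1\<close> comes from the factor
      \<open>exp (- t)\<close> inside \<open>g\<close> and keeps the Laplace argument positive at
      \<open>k = 0\<close>.\<close>
    have summand: "Bernstein N k (exp (- t)) * g t =
                real (N choose k) * laplace_integrand h (real k + 1) (N - k) t" for k t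
    proof -
      have "exp (- t) ^ k * exp (- t) = exp (- (real k + 1) * t)"
        by (simp add: algebra_simps flip: exp_of_nat_mult exp_add)
      thus ?thesis by (simp add: Bernstein_def g_def laplace_integrand_def algebra_simps)
    qed
    have "has_bochner_integral lborel
            (\<lambda>t. \<Sum>k\<le>N. B (k / N) * (real (N choose k) * laplace_integrand h (real k + 1) (N - k) t))
            (\<Sum>k\<le>N. B (k / N) * (real (N choose k) * (fdiff ^^ (N - k)) (laplace h) (real k + 1)))"
      by (intro has_bochner_integral_sum has_bochner_integral_mult_right
            has_bochner_integral_laplace_integrand h) auto
    moreover have "(\<Sum>k\<le>N. B (k / N) * (real (N choose k) * laplace_integrand h (real k + 1) (N - k) t)) =
                   P (exp (- t)) * g t" for t
      by (simp add: P_def sum_distrib_right mult.assoc summand)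
    ultimately have P: "has_bochner_integral lborel (\<lambda>t. P (exp (- t)) * g t)
            (\<Sum>k\<le>N. B (k / N) * (real (N choose k) * (fdiff ^^ (N - k)) (laplace h) (real k + 1)))" by simp
    have P_nonneg: "(\<Sum>k\<le>N. B (k / N) * (real (N choose k) * (fdiff ^^ (N - k)) (laplace h) (real k + 1))) \<ge> 0"
      by (intro sum_nonneg mult_nonneg_nonneg mom B_nonneg) (auto simp: divide_le_eq_1)
    have "integral\<^sup>L lborel w \<le> integral\<^sup>L lborel (\<lambda>t. e * \<bar>g t\<bar> - P (exp (- t)) * g t)"
    proof (rule integral_mono)
      show "integrable lborel (\<lambda>t. e * \<bar>g t\<bar> - P (exp (- t)) * g t)"
        using P g by (auto simp: has_bochner_integral_iff)
      fix t
      show "w t \<le> e * \<bar>g t\<bar> - P (exp (- t)) * g t"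
      proof (cases "t > 0")
        case True
        hence "\<bar>P (exp (- t)) - B (exp (- t))\<bar> * \<bar>g t\<bar> \<le> e * \<bar>g t\<bar>"
          using N[of "exp (- t)"] by (intro mult_right_mono) (auto simp: P_def abs_minus_commute)
        hence "(P (exp (- t)) - B (exp (- t))) * g t \<le> e * \<bar>g t\<bar>"
          by (simp flip: abs_mult) 
        thus ?thesis by (simp add: w_def algebra_simps)
      qed (simp add: w_def g_def laplace_integrand_def)
    qed (fact w_int)
    also have "\<dots> \<le> e * integral\<^sup>L lborel (\<lambda>t. \<bar>g t\<bar>)"
      using P P_nonneg g by (simp add: has_bochner_integral_iff)
    finally show ?thesis .
  qed
  hence "integral\<^sup>L lborel w \<le> 0"
  proof (cases "integral\<^sup>L lborel (\<lambda>t. \<bar>g t\<bar>) = 0")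
    case False
    hence J: "integral\<^sup>L lborel (\<lambda>t. \<bar>g t\<bar>) > 0"
      using integral_nonneg_AE[of "\<lambda>t. \<bar>g t\<bar>" lborel] by (simp add: order_less_le)
    assume *: "\<And>e. e > 0 \<Longrightarrow> integral\<^sup>L lborel w \<le> e * integral\<^sup>L lborel (\<lambda>t. \<bar>g t\<bar>)"
    show ?thesis
    proof (rule ccontr)
      assume "\<not> ?thesis"
      with *[of "integral\<^sup>L lborel w / (2 * integral\<^sup>L lborel (\<lambda>t. \<bar>g t\<bar>))"] J
      show False by (simp add: field_simps)
    qed
  qed (metis mult_zero_right zero_less_one)
  moreover have "integral\<^sup>L lborel w \<ge> 0" using w_nonneg by (simp add: integral_nonneg_AE)
  ultimately have "AE t in lborel. w t = 0"
    using integral_nonneg_eq_0_iff_AE[OF w_int] w_nonneg by simp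
  moreover define U where "U = {t \<in> {0<..}. h t < 0}"
  have w_pos: "w t > 0" if "t \<in> U" for t
    using that unfolding w_eq' U_def by (auto intro!: mult_pos_pos divide_pos_pos)
  ultimately have "AE t in lborel. t \<notin> U" by (auto elim!: eventually_mono simp: less_le)
  moreover have U: "open U"
  proof -
    have "U = {0<..} \<inter> h -` {..<0}" by (auto simp: U_def)
    thus ?thesis using continuous_open_preimage[OF cont open_greaterThan open_lessThan] by simp
  qed
  ultimately have "U \<in> null_sets lborel"
    using AE_iff_null_sets[of U lborel] by simp
  hence "negligible U"
    by (simp add: negligible_iff_null_sets null_sets_completionI)
  hence "U = {}" using U open_not_negligible by blast
  thus ?thesis using assms(3) unfolding U_def by force
qed

subsection \<open>Wright functions as power series\<close>

definition wright_coeff :: "real \<Rightarrow> real \<Rightarrow> nat \<Rightarrow> real" where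
  "wright_coeff \<nu> b n = 1 / (fact n * Gamma (real n * (- \<nu>) + b))"

lemma wright_conv_coeff: "wright z (- \<nu>) b = (\<Sum>n. wright_coeff \<nu> b n * z ^ n)"
  by (simp add: wright_def wright_coeff_def)

lemma diffs_wright_coeff: "diffs (wright_coeff \<nu> b) = wright_coeff \<nu> (b - \<nu>)"
proof
  fix n
  have "real (Suc n) * (- \<nu>) + b = real n * (- \<nu>) + (b - \<nu>)" by (simp add: algebra_simps)
  thus "diffs (wright_coeff \<nu> b) n = wright_coeff \<nu> (b - \<nu>) n"
    unfolding diffs_def wright_coeff_def by (simp only: fact_Suc) (simp add: divide_simps)
qed

lemma summable_norm_wright_coeff:
  assumes "0 < \<nu>" "\<nu> < 1" "b < 1"
  shows "summable (\<lambda>n. \<bar>wright_coeff \<nu> b n * z ^ n\<bar>)"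
proof (rule summable_comparison_test'[OF summable_Gamma_power[OF assms, of z]])
  fix n
  have "real n * \<nu> \<ge> 0" using assms by simp
  hence pos: "1 - (real n * (- \<nu>) + b) > 0" using assms(3) by linarith
  hence "\<bar>inverse (Gamma (real n * (- \<nu>) + b))\<bar> =
         Gamma (1 - (real n * (- \<nu>) + b)) * \<bar>sin (pi * (real n * (- \<nu>) + b))\<bar> / pi"
    by (subst inverse_Gamma_reflection_real) (use pos Gamma_real_pos[OF pos] in \<open>auto simp: abs_mult\<close>)
  also have "\<dots> \<le> Gamma (1 - (real n * (- \<nu>) + b)) * 1 / 1"
    using pi_gt3 pos by (intro frac_le mult_mono) (auto intro: less_imp_le)
  finally have le: "\<bar>inverse (Gamma (real n * (- \<nu>) + b))\<bar> \<le> Gamma (1 - b + real n * \<nu>)"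
    by (simp add: algebra_simps)
  have "\<bar>wright_coeff \<nu> b n * z ^ n\<bar> = \<bar>z\<bar> ^ n / fact n * \<bar>inverse (Gamma (real n * (- \<nu>) + b))\<bar>"
    by (simp add: wright_coeff_def abs_mult power_abs field_simps)
  also have "\<dots> \<le> \<bar>z\<bar> ^ n / fact n * Gamma (1 - b + real n * \<nu>)"
    by (intro mult_left_mono le) auto
  finally show "norm \<bar>wright_coeff \<nu> b n * z ^ n\<bar> \<le> \<bar>z\<bar> ^ n / fact n * Gamma (1 - b + real n * \<nu>)"
    by simp
qed

text \<open>The reflection bound requires \<open>b < 1\<close>, whereas the temperature has
  \<open>b = 1\<close>. Comparison with the termwise derivative, whose parameter is
  \<open>b - \<nu>\<close>, gains the missing room.\<close>

lemma summable_wright_coeff: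
  assumes "0 < \<nu>" "\<nu> < 1" "b < 1 + \<nu>"
  shows "summable (\<lambda>n. wright_coeff \<nu> b n * z ^ n)"
proof -
  have "summable (\<lambda>n. \<bar>z\<bar> * \<bar>wright_coeff \<nu> (b - \<nu>) n * z ^ n\<bar>)"
    using assms by (intro summable_mult summable_norm_wright_coeff) auto
  hence "summable (\<lambda>n. wright_coeff \<nu> b (Suc n) * z ^ Suc n)"
  proof (rule summable_comparison_test')
    fix n
    have "real (Suc n) * wright_coeff \<nu> b (Suc n) = wright_coeff \<nu> (b - \<nu>) n"
      using fun_cong[OF diffs_wright_coeff[of \<nu> b], of n] by (simp add: diffs_def)
    hence "\<bar>wright_coeff \<nu> (b - \<nu>) n\<bar> = real (Suc n) * \<bar>wright_coeff \<nu> b (Suc n)\<bar>"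
      by (metis abs_mult abs_of_nat)
    moreover have "1 * \<bar>wright_coeff \<nu> b (Suc n)\<bar> \<le> real (Suc n) * \<bar>wright_coeff \<nu> b (Suc n)\<bar>"
      by (intro mult_right_mono) auto
    ultimately have "\<bar>wright_coeff \<nu> b (Suc n)\<bar> \<le> \<bar>wright_coeff \<nu> (b - \<nu>) n\<bar>" by simp
    hence "\<bar>z\<bar> * (\<bar>wright_coeff \<nu> b (Suc n)\<bar> * \<bar>z ^ n\<bar>) \<le> \<bar>z\<bar> * (\<bar>wright_coeff \<nu> (b - \<nu>) n\<bar> * \<bar>z ^ n\<bar>)"
      by (intro mult_left_mono mult_right_mono) auto
    thus "norm (wright_coeff \<nu> b (Suc n) * z ^ Suc n) \<le> \<bar>z\<bar> * \<bar>wright_coeff \<nu> (b - \<nu>) n * z ^ n\<bar>"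
      by (simp add: abs_mult mult_ac)
  qed
  thus ?thesis by (subst (asm) summable_Suc_iff)
qed

lemma wright_has_real_derivative:
  assumes "0 < \<nu>" "\<nu> < 1" "b < 1 + \<nu>"
  shows "((\<lambda>z. wright z (- \<nu>) b) has_real_derivative wright z (- \<nu>) (b - \<nu>)) (at z)"
  unfolding wright_conv_coeff diffs_wright_coeff[symmetric]
  by (rule termdiffs_strong_converges_everywhere) (use assms summable_wright_coeff in auto)

lemma isCont_wright:
  assumes "0 < \<nu>" "\<nu> < 1" "b < 1 + \<nu>"
  shows "isCont (\<lambda>z. wright z (- \<nu>) b) z"
  using wright_has_real_derivative[OF assms] by (rule DERIV_isCont)

lemma continuous_on_wright [continuous_intros]:
  assumes "0 < \<nu>" "\<nu> < 1" "b < 1 + \<nu>" "continuous_on A f"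
  shows "continuous_on A (\<lambda>x. wright (f x) (- \<nu>) b)"
proof (rule continuous_on_compose2[OF _ assms(4)])
  show "continuous_on UNIV (\<lambda>z. wright z (- \<nu>) b)"
    by (intro continuous_at_imp_continuous_on ballI isCont_wright[OF assms(1-3)])
qed simp

lemma continuous_on_wright_profile:
  assumes "0 < \<nu>" "\<nu> < 1" "b < 1"
  shows "continuous_on {0<..} (wright_profile \<nu> b y)"
  unfolding wright_profile_def using assms by (intro continuous_intros) auto

subsection \<open>Laplace transforms of Wright functions\<close>

lemma has_bochner_integral_exp_Ioi:
  fixes a :: real
  assumes "a > 0"
  shows "has_bochner_integral lborel (\<lambda>t. indicator {0<..} t * exp (- a * t)) (1 / a)"
proof -
  have "((\<lambda>t. exp (- a * t)) has_integral 1 / a) {0..}"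
    using has_integral_exp_minus_to_infinity[OF assms, of 0] by simp
  hence "((\<lambda>t. exp (- a * t)) has_integral 1 / a) {0<..}"
  proof (rule has_integral_spike_set_eq[THEN iffD1, rotated -1])
    show "negligible {x \<in> {0..} - {0<..}. exp (- a * x) \<noteq> 0}"
      by (rule negligible_subset[of "{0}"]) auto
  qed (auto intro: negligible_subset[of "{}"])
  hence "((\<lambda>t. indicator {0<..} t * exp (- a * t)) has_integral 1 / a) UNIV"
    by (subst (asm) has_integral_restrict_UNIV [symmetric])
       (auto simp: indicator_def elim!: has_integral_eq[rotated])
  hence "(\<integral>\<^sup>+t. ennreal (indicator {0<..} t * exp (- a * t)) \<partial>lborel) = ennreal (1 / a)"
    by (rule nn_integral_has_integral_lborel[rotated 2]) auto
  thus ?thesis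
    using assms by (intro has_bochner_integral_nn_integral) auto
qed

lemma has_bochner_integral_Gamma_scaled:
  fixes p s :: real
  assumes p: "p > 0" and s: "s > 0"
  shows "has_bochner_integral lborel (\<lambda>u. indicator {0<..} u * (u powr (p - 1) * exp (- s * u)))
           (Gamma p * s powr (- p))"
proof -
  let ?f = "\<lambda>t::real. indicator {0..} t * t powr (p - 1) / exp t"
  have "has_bochner_integral lborel ?f (Gamma p)"
    using p Gamma_conv_nn_integral_real[OF p]
    by (intro has_bochner_integral_nn_integral) auto
  hence f: "integrable lborel ?f" "integral\<^sup>L lborel ?f = Gamma p"
    by (auto simp: has_bochner_integral_iff)
  have "has_bochner_integral lborel (\<lambda>u. ?f (0 + s * u)) (Gamma p / s)"
    using lborel_integrable_real_affine[OF f(1), of s 0] lborel_integral_real_affine[of s ?f 0] f s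
    by (auto simp: has_bochner_integral_iff field_simps)
  from has_bochner_integral_mult_right[OF this, of "s powr (1 - p)"]
  have "has_bochner_integral lborel (\<lambda>u. s powr (1 - p) * ?f (0 + s * u)) (s powr (1 - p) * (Gamma p / s))" .
  moreover have "s powr (1 - p) * ?f (0 + s * u) = indicator {0<..} u * (u powr (p - 1) * exp (- s * u))" for u
  proof (cases "u > 0")
    case True
    have "s powr (1 - p) * (s * u) powr (p - 1) = u powr (p - 1)"
      using s True by (simp add: powr_mult flip: powr_add)
    thus ?thesis using s True by (simp add: exp_minus field_simps)
  next
    case False
    thus ?thesis using s by (cases "u = 0") (auto simp: indicator_def zero_le_mult_iff)
  qed
  moreover have "s powr (1 - p) * (Gamma p / s) = Gamma p * s powr (- p)"
    using s by (simp add: powr_diff powr_minus field_simps)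
  ultimately show ?thesis by simp
qed

lemma has_bochner_integral_convolution:
  fixes K G :: "real \<Rightarrow> real"
  assumes K: "integrable lborel K" and G: "integrable lborel G"
  shows "has_bochner_integral lborel (\<lambda>t. LBINT \<tau>. K (t - \<tau>) * G \<tau>) (integral\<^sup>L lborel K * integral\<^sup>L lborel G)"
proof -
  let ?f = "\<lambda>(\<tau>, t). K (t - \<tau>) * G \<tau>"
  have [measurable]: "K \<in> borel_measurable borel" "G \<in> borel_measurable borel"
    using K G by auto
  have shift: "integrable lborel (\<lambda>t. K (t - \<tau>))" "(LBINT t. K (t - \<tau>)) = integral\<^sup>L lborel K"
              "(LBINT t. \<bar>K (t - \<tau>)\<bar>) = integral\<^sup>L lborel (\<lambda>u. \<bar>K u\<bar>)" for \<tau>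
    using lborel_integrable_real_affine[OF K, of 1 "- \<tau>"] lborel_integral_real_affine[of 1 K "- \<tau>"]
          lborel_integral_real_affine[of 1 "\<lambda>u. \<bar>K u\<bar>" "- \<tau>"]
    by (simp_all add: algebra_simps)
  have int: "integrable (lborel \<Otimes>\<^sub>M lborel) ?f"
  proof (rule lborel_pair.Fubini_integrable)
    show "integrable lborel (\<lambda>\<tau>. LBINT t. norm (?f (\<tau>, t)))"
      using G by (simp add: abs_mult shift)
  qed (use shift in auto)
  have "integrable lborel (\<lambda>t. LBINT \<tau>. K (t - \<tau>) * G \<tau>)"
    using lborel_pair.integrable_snd[OF int] by simp
  moreover have "(LBINT t. (LBINT \<tau>. K (t - \<tau>) * G \<tau>)) = (LBINT \<tau>. (LBINT t. K (t - \<tau>) * G \<tau>))"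
    using lborel_pair.Fubini_integral[OF int] by simp
  ultimately show ?thesis
    by (simp add: has_bochner_integral_iff shift)
qed

text \<open>After inserting the integral representation and exchanging integrals, the inner integral
  over \<open>t\<close> is \<open>1 / (s + exp x)\<close>, which leaves the Stieltjes integral
  computed above.\<close>

lemma laplace_wright_profile:
  assumes "0 < \<nu>" "\<nu> < 1 / 2" "b < 1" "y > 0"
  shows "laplace_transformable (wright_profile \<nu> b y)"
    and "s > 0 \<Longrightarrow> laplace (wright_profile \<nu> b y) s = s powr (- b) * exp (- y * s powr \<nu>)"
proof -
  let ?h = "wright_profile \<nu> b y"
  have main: "has_bochner_integral lborel (laplace_integrand ?h s 0) (s powr (- b) * exp (- y * s powr \<nu>))"
    if s: "s > 0" for s
  proof -
    define k where "k = (\<lambda>x. exp ((1 - b) * x) * wright_kernel \<nu> b y x / pi)"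
    let ?f = "\<lambda>(x, t). k x * (indicator {0<..} t * exp (- (s + exp x) * t))"
    have [measurable]: "k \<in> borel_measurable borel" unfolding k_def by measurable
    have e: "has_bochner_integral lborel (\<lambda>t. indicator {0<..} t * exp (- (s + exp x) * t)) (1 / (s + exp x))" for x
      using s by (intro has_bochner_integral_exp_Ioi add_pos_pos) auto
    have k: "integrable lborel (\<lambda>x. k x / (s + exp x))"
    proof -
      have "k x / (s + exp x) = exp ((1 - b) * x) * wright_kernel \<nu> b y x / (exp x + s) / pi" for x
        by (simp add: k_def add.commute mult.commute)
      thus ?thesis
        using integrable_divide[OF integrable_exp_wright_kernel_Stieltjes[OF assms s], of pi] by simp
    qed
    have int: "integrable (lborel \<Otimes>\<^sub>M lborel) ?f"
    proof (rule lborel_pair.Fubini_integrable)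
      have "(LBINT t. norm (?f (x, t))) = \<bar>k x / (s + exp x)\<bar>" for x
        using e[of x] s by (simp add: abs_mult has_bochner_integral_iff add_pos_pos abs_of_pos)
      thus "integrable lborel (\<lambda>x. LBINT t. norm (?f (x, t)))"
        using integrable_abs[OF k] by (simp only:)
      show "AE x in lborel. integrable lborel (\<lambda>t. ?f (x, t))"
        using e by (auto simp: has_bochner_integral_iff intro!: integrable_mult_right)
    qed measurable
    have inner: "(LBINT x. ?f (x, t)) = laplace_integrand ?h s 0 t" for t
    proof (cases "t > 0")
      case True
      have "(LBINT x. exp (- s * t) * (exp ((1 - b) * x - t * exp x) * wright_kernel \<nu> b y x / pi)) =
            exp (- s * t) * ?h t"
        by (intro has_bochner_integral_integral_eq has_bochner_integral_mult_right
              wright_integral_representation) (use assms True in auto)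
      moreover have "?f (x, t) = exp (- s * t) * (exp ((1 - b) * x - t * exp x) * wright_kernel \<nu> b y x / pi)" for x
        using True by (simp add: k_def algebra_simps exp_diff exp_minus exp_add field_simps)
      ultimately show ?thesis using True by (simp add: laplace_integrand_def)
    qed (simp add: laplace_integrand_def)
    have "integrable lborel (laplace_integrand ?h s 0)"
      using lborel_pair.integrable_snd[OF int] inner by simp
    moreover have "integral\<^sup>L lborel (laplace_integrand ?h s 0) = s powr (- b) * exp (- y * s powr \<nu>)"
    proof -
      have "integral\<^sup>L lborel (laplace_integrand ?h s 0) = (LBINT t. (LBINT x. ?f (x, t)))"
        by (rule Bochner_Integration.integral_cong[OF refl inner[symmetric]])
      also have "\<dots> = (LBINT x. (LBINT t. ?f (x, t)))"
        using lborel_pair.Fubini_integral[OF int] by (simp only: prod.case)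
      also have "\<dots> = (LBINT x. exp ((1 - b) * x) * wright_kernel \<nu> b y x / (exp x + s) / pi)"
      proof (rule Bochner_Integration.integral_cong[OF refl])
        fix x
        have "(LBINT t. ?f (x, t)) = k x * (1 / (s + exp x))"
          using has_bochner_integral_mult_right[OF e[of x], of "k x"]
          by (auto dest: has_bochner_integral_integral_eq)
        thus "(LBINT t. ?f (x, t)) = exp ((1 - b) * x) * wright_kernel \<nu> b y x / (exp x + s) / pi"
          by (simp add: k_def add.commute mult.commute)
      qed
      also have "\<dots> = s powr (- b) * exp (- y * s powr \<nu>)"
        unfolding integral_divide_zero wright_kernel_Stieltjes[OF assms s] by simp
      finally show ?thesis .
    qed
    ultimately show ?thesis by (simp add: has_bochner_integral_iff)
  qed
  show "laplace_transformable ?h"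
    using main continuous_on_wright_profile[of \<nu> b y] assms
    by (auto simp: laplace_transformable_def has_bochner_integral_iff)
  show "s > 0 \<Longrightarrow> laplace ?h s = s powr (- b) * exp (- y * s powr \<nu>)"
    using main[of s] by (simp add: laplace_def has_bochner_integral_iff)
qed

section \<open>Uniqueness, nonnegativity and boundedness of the profiles\<close>

lemma fdiff_power_cong:
  assumes "\<And>s. s > 0 \<Longrightarrow> F s = G s" "s > 0"
  shows "(fdiff ^^ m) F s = (fdiff ^^ m) G s"
  using assms(2)
proof (induction m arbitrary: s)
  case (Suc m)
  thus ?case by (simp add: fdiff_def[of "(fdiff ^^ m) F"] fdiff_def[of "(fdiff ^^ m) G"])
qed (use assms(1) in auto)

lemma fdiff_power_zero: "(fdiff ^^ m) (\<lambda>_. 0) s = 0"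
  by (induction m arbitrary: s) (simp_all add: fdiff_def)

text \<open>The difference of the two functions has transform 0, hence vanishing differences of all
  orders, so it is nonnegative; exchanging the functions gives the other inequality.\<close>

lemma laplace_unique:
  assumes h: "laplace_transformable h1" "laplace_transformable h2"
  assumes eq: "\<And>s. s > 0 \<Longrightarrow> laplace h1 s = laplace h2 s" and t: "t > 0"
  shows "h1 t = h2 t"
proof -
  have "f t \<le> g t" if fg: "laplace_transformable f" "laplace_transformable g"
    and eq: "\<And>s. s > 0 \<Longrightarrow> laplace f s = laplace g s" for f g
  proof -
    let ?d = "\<lambda>t. g t - f t"
    have d: "laplace_integrand ?d s 0 = (\<lambda>t. laplace_integrand g s 0 t - laplace_integrand f s 0 t)" for s
      by (auto simp: laplace_integrand_def algebra_simps)
    have "laplace_transformable ?d"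
      using fg by (auto simp: laplace_transformable_def d intro!: continuous_intros)
    moreover have "laplace ?d s = 0" if "s > 0" for s
      using fg eq[OF that] that unfolding laplace_def d
      by (subst Bochner_Integration.integral_diff) (auto simp: laplace_transformable_def)
    hence "(fdiff ^^ m) (laplace ?d) s = 0" if "s > 0" for m s
      using that fdiff_power_cong[of "laplace ?d" "\<lambda>_. 0" s m] by (simp add: fdiff_power_zero)
    ultimately show ?thesis
      using laplace_fdiff_nonneg_imp_nonneg[of ?d t] t by force
  qed
  from this[of h1 h2] this[of h2 h1] h eq show ?thesis by fastforce
qed

lemma wright_profile_0_nonneg:
  assumes "0 < \<nu>" "\<nu> < 1 / 2" "y > 0" "t > 0"
  shows "wright_profile \<nu> 0 y t \<ge> 0"
proof (rule laplace_fdiff_nonneg_imp_nonneg[where h = "wright_profile \<nu> 0 y"])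
  show "laplace_transformable (wright_profile \<nu> 0 y)"
    using assms by (intro laplace_wright_profile) auto
  fix m s assume s: "(s::real) > 0"
  let ?F = "\<lambda>s. s powr (- 0) * exp (- y * s powr \<nu>)"
  have "(fdiff ^^ m) (laplace (wright_profile \<nu> 0 y)) s = (fdiff ^^ m) ?F s"
    using assms s by (intro fdiff_power_cong laplace_wright_profile) auto
  also have "\<dots> \<ge> 0"
  proof (rule fdiff_power_nonneg[where C = "stretched_exp_cone \<nu> y"])
    show "?F \<in> stretched_exp_cone \<nu> y" by (rule stretched_exp_cone.base) simp
  qed (use assms s in \<open>auto intro: stretched_exp_cone_nonneg stretched_exp_cone_deriv\<close>)
  finally show "(fdiff ^^ m) (laplace (wright_profile \<nu> 0 y)) s \<ge> 0" .
qed (use assms in auto)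

text \<open>Dropping \<open>exp (- t * exp x) \<le> 1\<close> leaves an integral independent of
  \<open>t\<close>. Uniformity as \<open>t\<close> approaches 0 is what makes the Abel integrals
  converge at their left end.\<close>

lemma wright_profile_bounded:
  assumes "0 < \<nu>" "\<nu> < 1 / 2" "b < 1" "y > 0"
  obtains C where "C > 0" "\<And>t. t > 0 \<Longrightarrow> \<bar>wright_profile \<nu> b y t\<bar> \<le> C"
proof -
  let ?k = "\<lambda>x. exp ((1 - b) * x) * wright_kernel \<nu> b y x"
  define C where "C = (LBINT x. \<bar>?k x\<bar>) / pi"
  have k: "integrable lborel ?k" by (rule integrable_exp_wright_kernel[OF assms])
  have "\<bar>wright_profile \<nu> b y t\<bar> \<le> C" if t: "t > 0" for t
  proof -
    let ?f = "\<lambda>x. exp ((1 - b) * x - t * exp x) * wright_kernel \<nu> b y x / pi"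
    have f: "has_bochner_integral lborel ?f (wright_profile \<nu> b y t)"
      using assms t by (intro wright_integral_representation) auto
    hence "\<bar>wright_profile \<nu> b y t\<bar> \<le> (LBINT x. norm (?f x))"
      using integral_norm_bound[of lborel ?f] by (simp add: has_bochner_integral_iff)
    also have "\<dots> \<le> (LBINT x. \<bar>?k x\<bar> / pi)"
    proof (rule integral_mono)
      show "integrable lborel (\<lambda>x. norm (?f x))" by (intro integrable_norm integrable.intros[OF f])
      show "integrable lborel (\<lambda>x. \<bar>?k x\<bar> / pi)" using k by (intro integrable_divide integrable_abs) auto
      fix x
      have "exp ((1 - b) * x - t * exp x) \<le> exp ((1 - b) * x)" using t by simp
      thus "norm (?f x) \<le> \<bar>?k x\<bar> / pi"
        by (simp add: abs_mult divide_right_mono mult_right_mono)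
    qed
    also have "\<dots> = C" by (simp add: C_def)
    finally show ?thesis .
  qed
  hence "\<bar>wright_profile \<nu> b y t\<bar> \<le> \<bar>C\<bar> + 1" if "t > 0" for t using that by force
  thus ?thesis by (intro that[of "\<bar>C\<bar> + 1"]) auto
qed

subsection \<open>Abel integrals of Wright functions\<close>

text \<open>The indicators turn the integral over \<open>{0<..<t}\<close> into a convolution on the
  whole line.\<close>

definition abel_integrand :: "real \<Rightarrow> (real \<Rightarrow> real) \<Rightarrow> real \<Rightarrow> real \<Rightarrow> real" where
  "abel_integrand a g t \<tau> = indicator {0<..} (t - \<tau>) * (t - \<tau>) powr (- a) * (indicator {0<..} \<tau> * g \<tau>)"

definition abel :: "real \<Rightarrow> (real \<Rightarrow> real) \<Rightarrow> real \<Rightarrow> real" where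
  "abel a g t = (LBINT \<tau>. abel_integrand a g t \<tau>)"

lemma integrable_abel_kernel:
  fixes a :: real
  assumes "a < 1"
  shows "integrable lborel (\<lambda>u. indicator {0<..<1} u * (1 - u) powr (- a))"
proof (rule Bochner_Integration.integrable_bound)
  show "integrable lborel (\<lambda>t. indicator {0..1} t *\<^sub>R (t powr (1 - 1) * (1 - t) powr (1 - a - 1)))"
    using integrable_Beta[of 1 "1 - a"] assms by (simp add: set_integrable_def)
qed (auto simp: indicator_def)

text \<open>Substituting \<open>\<tau> = t * u\<close> fixes the singular kernel on the unit
  interval and puts \<open>t\<close> only into the bounded continuous factor, so dominated
  convergence applies.\<close>

lemma
  assumes a: "a < 1" and g: "continuous_on {0<..} g" and C: "\<And>t. t > 0 \<Longrightarrow> \<bar>g t\<bar> \<le> C"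
  shows integrable_abel_integrand: "t > 0 \<Longrightarrow> integrable lborel (abel_integrand a g t)"
    and continuous_on_abel: "continuous_on {0<..} (abel a g)"
proof -
  define g' where "g' = (\<lambda>\<tau>. indicator {0<..} \<tau> * g \<tau>)"
  have [measurable]: "g' \<in> borel_measurable borel"
    unfolding g'_def using borel_measurable_continuous_on_indicator[OF _ g] by simp
  have C0: "C \<ge> 0" using C[of 1] by (smt (verit) abs_ge_zero zero_less_one)
  have g'_le: "\<bar>g' \<tau>\<bar> \<le> C" for \<tau>
    using C[of \<tau>] C0 by (auto simp: g'_def indicator_def)
  define k where "k = (\<lambda>u. indicator {0<..<1} u * (1 - u) powr (- a))"
  have k: "integrable lborel (\<lambda>u. C * k u)"
    unfolding k_def using integrable_abel_kernel[OF a] by (rule integrable_mult_right)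
  have k_meas [measurable]: "k \<in> borel_measurable borel" unfolding k_def by measurable
  have k_nonneg: "k u \<ge> 0" for u by (simp add: k_def)
  have bound: "norm (k u * g' (t * u)) \<le> C * k u" for t u
    using mult_left_mono[OF g'_le[of "t * u"] k_nonneg[of u]] k_nonneg[of u]
    by (simp add: abs_mult mult.commute)
  have int: "integrable lborel (\<lambda>u. k u * g' (t * u))" for t
    by (rule Bochner_Integration.integrable_bound[OF k])
       (use bound C0 k_nonneg in \<open>auto simp: abs_mult\<close>)
  have scale: "abel_integrand a g t (0 + t * u) = t powr (- a) * (k u * g' (t * u))" if t: "t > 0" for t u
  proof (cases "0 < u \<and> u < 1")
    case True
    have "(t - t * u) powr (- a) = t powr (- a) * (1 - u) powr (- a)"
      using True t powr_mult[of t "1 - u" "- a"] by (simp add: algebra_simps)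
    thus ?thesis using True t by (simp add: abel_integrand_def k_def g'_def)
  next
    case False
    thus ?thesis using t by (auto simp: abel_integrand_def k_def g'_def indicator_def zero_less_mult_iff)
  qed
  have eq: "abel a g t = t powr (1 - a) * (LBINT u. k u * g' (t * u))" if t: "t > 0" for t
  proof -
    have "abel a g t = \<bar>t\<bar> * (LBINT u. abel_integrand a g t (0 + t * u))"
      unfolding abel_def using t by (subst lborel_integral_real_affine[of t _ 0]) auto
    also have "\<dots> = t powr (1 - a) * (LBINT u. k u * g' (t * u))"
      using t by (simp add: scale powr_diff powr_minus divide_simps del: add_0)
    finally show ?thesis .
  qed
  show "integrable lborel (abel_integrand a g t)" if t: "t > 0"
  proof -
    have "integrable lborel (\<lambda>u. abel_integrand a g t (0 + t * u))"
      unfolding scale[OF t] using int by (rule integrable_mult_right)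
    thus ?thesis using t lborel_integrable_real_affine_iff[of t "abel_integrand a g t" 0] by simp
  qed
  have "continuous_on {0<..} (\<lambda>t. LBINT u. k u * g' (t * u))"
    unfolding continuous_on_sequentially o_def
  proof (intro allI ballI impI)
    fix x :: "nat \<Rightarrow> real" and t :: real
    assume t: "t \<in> {0<..}" "(\<forall>n. x n \<in> {0<..}) \<and> x \<longlonglongrightarrow> t"
    show "(\<lambda>n. LBINT u. k u * g' (x n * u)) \<longlonglongrightarrow> (LBINT u. k u * g' (t * u))"
    proof (rule integral_dominated_convergence[OF _ _ k])
      have "(\<lambda>n. k u * g' (x n * u)) \<longlonglongrightarrow> k u * g' (t * u)" for u
      proof (cases "u > 0")
        case True
        have "(\<lambda>n. g (x n * u)) \<longlonglongrightarrow> g (t * u)"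
          by (rule continuous_on_tendsto_compose[OF g]) (use t True in \<open>auto intro!: tendsto_intros\<close>)
        thus ?thesis using t True by (auto simp: g'_def intro!: tendsto_intros)
      qed (simp add: k_def)
      thus "AE u in lborel. (\<lambda>n. k u * g' (x n * u)) \<longlonglongrightarrow> k u * g' (t * u)" by simp
    qed (use bound in auto)
  qed
  hence "continuous_on {0<..} (\<lambda>t. t powr (1 - a) * (LBINT u. k u * g' (t * u)))"
    by (intro continuous_intros) auto
  thus "continuous_on {0<..} (abel a g)"
    by (rule continuous_on_cong[THEN iffD1, rotated -1]) (auto simp: eq)
qed

text \<open>The Abel kernel has transform \<open>Gamma (1 - a) * s powr (a - 1)\<close>. Multiplied
  by \<open>exp (- y * s powr \<nu>)\<close> it is \<open>Gamma (1 - a)\<close> times the transform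
  of the profile with \<open>b = 1 - a\<close>.\<close>

lemma abel_wright_profile:
  assumes \<nu>: "0 < \<nu>" "\<nu> < 1 / 2" and a: "0 < a" "a < 1" and y: "y > 0" and t: "t > 0"
  shows "abel a (wright_profile \<nu> 0 y) t = Gamma (1 - a) * wright_profile \<nu> (1 - a) y t"
proof (rule laplace_unique[OF _ _ _ t])
  let ?g = "wright_profile \<nu> 0 y" and ?w = "wright_profile \<nu> (1 - a) y"
  obtain C where C: "\<And>t. t > 0 \<Longrightarrow> \<bar>?g t\<bar> \<le> C"
    by (rule wright_profile_bounded[of \<nu> 0 y]) (use assms in auto)
  have g: "laplace_transformable ?g" "\<And>s. s > 0 \<Longrightarrow> laplace ?g s = exp (- y * s powr \<nu>)"
    using laplace_wright_profile[of \<nu> 0 y] assms by auto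
  have w: "laplace_transformable ?w" "\<And>s. s > 0 \<Longrightarrow> laplace ?w s = s powr (a - 1) * exp (- y * s powr \<nu>)"
    using laplace_wright_profile[of \<nu> "1 - a" y] assms by auto
  have cont: "continuous_on {0<..} ?g" using g by (simp add: laplace_transformable_def)
  have conv: "has_bochner_integral lborel (laplace_integrand (abel a ?g) s 0)
                (Gamma (1 - a) * s powr (a - 1) * exp (- y * s powr \<nu>))" if s: "s > 0" for s
  proof -
    let ?K = "\<lambda>u::real. indicator {0<..} u * (u powr ((1 - a) - 1) * exp (- s * u))"
    let ?G = "laplace_integrand ?g s 0"
    have K: "has_bochner_integral lborel ?K (Gamma (1 - a) * s powr (- (1 - a)))"
      using a s by (intro has_bochner_integral_Gamma_scaled) auto
    have G: "has_bochner_integral lborel ?G (exp (- y * s powr \<nu>))"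
      using g s by (auto simp: laplace_transformable_def laplace_def has_bochner_integral_iff)
    have "has_bochner_integral lborel (\<lambda>t. LBINT \<tau>. ?K (t - \<tau>) * ?G \<tau>)
            (Gamma (1 - a) * s powr (- (1 - a)) * exp (- y * s powr \<nu>))"
      using has_bochner_integral_convolution[of ?K ?G] K G by (simp add: has_bochner_integral_iff)
    moreover have "(LBINT \<tau>. ?K (t - \<tau>) * ?G \<tau>) = laplace_integrand (abel a ?g) s 0 t" for t
    proof (cases "t > 0")
      case True
      have "?K (t - \<tau>) * ?G \<tau> = exp (- s * t) * abel_integrand a ?g t \<tau>" for \<tau>
        by (simp add: laplace_integrand_def abel_integrand_def algebra_simps exp_diff exp_minus
              field_simps split: split_indicator)
      thus ?thesis using True by (simp add: laplace_integrand_def abel_def)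
    next
      case False
      hence "?K (t - \<tau>) * ?G \<tau> = 0" for \<tau>
        by (auto simp: laplace_integrand_def indicator_def)
      hence "(LBINT \<tau>. ?K (t - \<tau>) * ?G \<tau>) = 0" by (simp only: integral_zero)
      thus ?thesis using False by (simp add: laplace_integrand_def)
    qed
    ultimately show ?thesis by simp
  qed
  show "laplace_transformable (abel a ?g)"
    using conv continuous_on_abel[OF a(2) cont C]
    by (auto simp: laplace_transformable_def has_bochner_integral_iff)
  have w': "laplace_integrand (\<lambda>t. Gamma (1 - a) * ?w t) s 0 =
              (\<lambda>t. Gamma (1 - a) * laplace_integrand ?w s 0 t)" for s
    by (auto simp: laplace_integrand_def)
  show "laplace_transformable (\<lambda>t. Gamma (1 - a) * ?w t)"
    using w(1) unfolding laplace_transformable_def w'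
    by (auto intro!: continuous_intros)
  fix s :: real assume s: "s > 0"
  have "laplace (abel a ?g) s = Gamma (1 - a) * (s powr (a - 1) * exp (- y * s powr \<nu>))"
    using conv[OF s] by (simp add: laplace_def has_bochner_integral_iff)
  also have "\<dots> = laplace (\<lambda>t. Gamma (1 - a) * ?w t) s"
    using w(2)[OF s] unfolding laplace_def w' by simp
  finally show "laplace (abel a ?g) s = laplace (\<lambda>t. Gamma (1 - a) * ?w t) s" .
qed

lemma has_integral_abel:
  assumes "t > 0" "integrable lborel (abel_integrand a g t)"
  shows "((\<lambda>\<tau>. g \<tau> / (t - \<tau>) powr a) has_integral abel a g t) {0<..<t}"
proof -
  have "(abel_integrand a g t has_integral abel a g t) UNIV"
    unfolding abel_def by (rule has_integral_integral_lborel[OF assms(2)])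
  moreover have "abel_integrand a g t = (\<lambda>\<tau>. if \<tau> \<in> {0<..<t} then g \<tau> / (t - \<tau>) powr a else 0)"
    by (auto simp: abel_integrand_def indicator_def fun_eq_iff powr_minus field_simps)
  ultimately have "((\<lambda>\<tau>. if \<tau> \<in> {0<..<t} then g \<tau> / (t - \<tau>) powr a else 0) has_integral abel a g t) UNIV"
    by (simp only:)
  thus ?thesis by (rule has_integral_restrict_UNIV[THEN iffD1])
qed

subsection \<open>Positivity of the Mainardi function\<close>

lemma wright_at_0: "wright 0 a b = 1 / Gamma b"
  by (simp add: wright_def powser_zero[of "\<lambda>n. 1 / (fact n * Gamma (real n * a + b))", simplified]
      flip: divide_inverse)

text \<open>The constant term drops out because \<open>1 / Gamma 0 = 0\<close>; in the others the
  recurrence of the reciprocal Gamma function, valid at the poles too, yields a factor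
  \<open>- n * \<nu>\<close> whose \<open>n\<close> cancels in the factorial.\<close>

lemma wright_0_conv_mainardi:
  assumes "0 < \<nu>" "\<nu> < 1"
  shows "wright w (- \<nu>) 0 = - \<nu> * w * wright w (- \<nu>) (1 - \<nu>)"
proof -
  have c: "wright_coeff \<nu> 0 (Suc n) = - \<nu> * wright_coeff \<nu> (1 - \<nu>) n" for n
  proof -
    have eq: "real (Suc n) * (- \<nu>) + 1 = real n * (- \<nu>) + (1 - \<nu>)" by (simp add: algebra_simps)
    have "inverse (Gamma (real (Suc n) * (- \<nu>))) =
          (real (Suc n) * (- \<nu>)) * inverse (Gamma (real (Suc n) * (- \<nu>) + 1))"
      using rGamma_plus1[of "real (Suc n) * (- \<nu>)"] by (simp add: Gamma_def)
    hence "wright_coeff \<nu> 0 (Suc n) =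
           inverse (fact (Suc n)) * ((real (Suc n) * (- \<nu>)) * inverse (Gamma (real (Suc n) * (- \<nu>) + 1)))"
      by (simp add: wright_coeff_def divide_inverse)
    also have "\<dots> = - \<nu> * (inverse (fact n) * inverse (Gamma (real (Suc n) * (- \<nu>) + 1)))"
      by (simp only: fact_Suc) (simp add: field_simps del: of_nat_Suc)
    also have "\<dots> = - \<nu> * wright_coeff \<nu> (1 - \<nu>) n"
      unfolding eq by (simp add: wright_coeff_def divide_inverse)
    finally show ?thesis .
  qed
  have "wright w (- \<nu>) 0 = (\<Sum>n. wright_coeff \<nu> 0 (Suc n) * w ^ Suc n) + wright_coeff \<nu> 0 0"
    unfolding wright_conv_coeff using suminf_split_head[OF summable_wright_coeff[of \<nu> 0 w]] assms by simp
  also have "wright_coeff \<nu> 0 0 = 0" by (simp add: wright_coeff_def)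
  also have "(\<Sum>n. wright_coeff \<nu> 0 (Suc n) * w ^ Suc n) = (\<Sum>n. (- \<nu> * w) * (wright_coeff \<nu> (1 - \<nu>) n * w ^ n))"
    by (intro suminf_cong) (simp add: c)
  also have "\<dots> = (- \<nu> * w) * wright w (- \<nu>) (1 - \<nu>)"
    unfolding wright_conv_coeff using assms by (intro suminf_mult summable_wright_coeff) auto
  finally show ?thesis by simp
qed

lemma wright_minus_has_real_derivative:
  assumes "0 < \<nu>" "\<nu> < 1" "b < 1 + \<nu>"
  shows "((\<lambda>z. wright (- z) (- \<nu>) b) has_real_derivative - wright (- z) (- \<nu>) (b - \<nu>)) (at z)"
  using DERIV_chain2[OF wright_has_real_derivative[OF assms] DERIV_minus[OF DERIV_ident], of z UNIV] by simp

lemma mainardi_has_real_derivative: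
  assumes "0 < \<nu>" "\<nu> < 1"
  shows "(mainardi \<nu> has_real_derivative - wright (- z) (- \<nu>) (1 - 2 * \<nu>)) (at z)"
  using wright_minus_has_real_derivative[of \<nu> "1 - \<nu>" z] assms by (simp add: mainardi_def[abs_def])

lemma wright_profile_0_conv_mainardi:
  assumes "0 < \<nu>" "\<nu> < 1"
  shows "wright_profile \<nu> 0 y t = \<nu> * (y / t powr \<nu>) * mainardi \<nu> (y / t powr \<nu>) * t powr (- 1)"
  using assms by (simp add: wright_profile_def wright_0_conv_mainardi mainardi_def)

text \<open>The series extends to an entire function of a complex variable whose zeros accumulate at
  \<open>- z0\<close>, so the identity theorem applies.\<close>

lemma mainardi_eq_0_imp_all_0:
  assumes \<nu>: "0 < \<nu>" "\<nu> < 1" and z: "\<And>x. x \<ge> z0 \<Longrightarrow> mainardi \<nu> x = 0"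
  shows "mainardi \<nu> x = 0"
proof -
  define c where "c = (\<lambda>n. complex_of_real (wright_coeff \<nu> (1 - \<nu>) n))"
  define f where "f = (\<lambda>w. \<Sum>n. c n * w ^ n)"
  have summ: "summable (\<lambda>n. c n * w ^ n)" for w
  proof (rule summable_norm_cancel)
    show "summable (\<lambda>n. norm (c n * w ^ n))"
      using summable_norm_wright_coeff[of \<nu> "1 - \<nu>" "norm w"] \<nu>
      by (simp add: c_def norm_mult norm_power abs_mult)
  qed
  have "(f has_field_derivative (\<Sum>n. diffs c n * w ^ n)) (at w)" for w
    unfolding f_def by (rule termdiffs_strong_converges_everywhere[OF summ])
  hence hol: "f holomorphic_on UNIV"
    by (auto simp: holomorphic_on_def field_differentiable_def intro: has_field_derivative_at_within)
  have f_real: "f (of_real (- x)) = of_real (mainardi \<nu> x)" for x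
  proof -
    have "(\<Sum>n. complex_of_real (wright_coeff \<nu> (1 - \<nu>) n * (- x) ^ n)) =
          of_real (\<Sum>n. wright_coeff \<nu> (1 - \<nu>) n * (- x) ^ n)"
      by (rule suminf_of_real[symmetric], rule summable_wright_coeff) (use \<nu> in auto)
    thus ?thesis by (simp add: f_def c_def mainardi_def wright_conv_coeff)
  qed
  let ?U = "(\<lambda>x. complex_of_real (- x)) ` {z0..}"
  have "f (of_real (- x)) = 0"
  proof (rule analytic_continuation[OF hol])
    show "complex_of_real (- z0) islimpt ?U"
      unfolding islimpt_sequential
    proof (intro exI[of _ "\<lambda>n. complex_of_real (- (z0 + 1 / real (Suc n)))"] conjI allI)
      have "(\<lambda>n. complex_of_real (- (z0 + 1 / real (Suc n)))) \<longlonglongrightarrow> complex_of_real (- (z0 + 0))"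
        by (intro tendsto_intros LIMSEQ_Suc[OF lim_1_over_n])
      thus "(\<lambda>n. complex_of_real (- (z0 + 1 / real (Suc n)))) \<longlonglongrightarrow> complex_of_real (- z0)" by simp
      show "complex_of_real (- (z0 + 1 / real (Suc n))) \<in> ?U - {complex_of_real (- z0)}" for n
      proof -
        have "complex_of_real (- (z0 + 1 / real (Suc n))) \<in> ?U" by (rule imageI) simp
        moreover have "complex_of_real (- (z0 + 1 / real (Suc n))) \<noteq> complex_of_real (- z0)"
          unfolding of_real_eq_iff by simp
        ultimately show ?thesis by blast
      qed
    qed
    show "f w = 0" if "w \<in> ?U" for w
      using that z by (auto simp: f_real simp del: of_real_minus)
  qed auto
  thus ?thesis by (simp add: f_real del: of_real_minus)
qed

lemma mainardi_0: "mainardi \<nu> 0 = 1 / Gamma (1 - \<nu>)"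
  by (simp add: mainardi_def wright_at_0)

lemma mainardi_nonneg:
  assumes "0 < \<nu>" "\<nu> < 1 / 2" "z \<ge> 0"
  shows "mainardi \<nu> z \<ge> 0"
proof (cases "z = 0")
  case False
  hence "wright_profile \<nu> 0 z 1 \<ge> 0" using assms by (intro wright_profile_0_nonneg) auto
  hence "\<nu> * z * mainardi \<nu> z \<ge> 0" using assms by (simp add: wright_profile_0_conv_mainardi)
  moreover have "\<nu> * z > 0" using assms False by simp
  ultimately show ?thesis by (metis linorder_not_less mult_pos_neg)
next
  case True
  have "Gamma (1 - \<nu>) > 0" using assms by (intro Gamma_real_pos) auto
  thus ?thesis using True by (simp add: mainardi_0)
qed

text \<open>The derivative has parameter \<open>1 - 2 * \<nu>\<close>, exactly what an Abel integral
  of order \<open>2 * \<nu>\<close> of the nonnegative \<open>b = 0\<close> profile produces at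
  \<open>t = 1\<close>.\<close>

lemma mainardi_antimono:
  assumes "0 < \<nu>" "\<nu> < 1 / 2" "0 \<le> x" "x \<le> z"
  shows "mainardi \<nu> z \<le> mainardi \<nu> x"
proof (rule DERIV_nonpos_imp_decreasing_open[OF assms(4)])
  show "continuous_on {x..z} (mainardi \<nu>)"
    using mainardi_has_real_derivative[of \<nu>] assms
    by (intro continuous_at_imp_continuous_on ballI DERIV_isCont) auto
  fix u assume u: "x < u" "u < z"
  have "abel (2 * \<nu>) (wright_profile \<nu> 0 u) 1 \<ge> 0"
    unfolding abel_def abel_integrand_def using assms u
    by (intro Bochner_Integration.integral_nonneg)
       (auto simp: indicator_def intro!: mult_nonneg_nonneg wright_profile_0_nonneg)
  hence "Gamma (1 - 2 * \<nu>) * wright (- u) (- \<nu>) (1 - 2 * \<nu>) \<ge> 0"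
    using abel_wright_profile[of \<nu> "2 * \<nu>" u 1] assms u by (simp add: wright_profile_def)
  moreover have "Gamma (1 - 2 * \<nu>) > 0" using assms by (intro Gamma_real_pos) auto
  ultimately have "wright (- u) (- \<nu>) (1 - 2 * \<nu>) \<ge> 0" by (simp add: zero_le_mult_iff)
  thus "\<exists>d. (mainardi \<nu> has_real_derivative d) (at u) \<and> d \<le> 0"
    using mainardi_has_real_derivative[of \<nu> u] assms by (intro exI conjI) auto
qed

text \<open>A zero would persist on the whole ray to its right by monotonicity, and then propagate
  back to 0, where the value is \<open>1 / Gamma (1 - \<nu>)\<close>.\<close>

lemma mainardi_pos:
  assumes "0 < \<nu>" "\<nu> < 1 / 2" "z \<ge> 0"
  shows "mainardi \<nu> z > 0"
proof (rule ccontr)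
  assume "\<not> ?thesis"
  hence z: "mainardi \<nu> z = 0" using mainardi_nonneg[OF assms] by simp
  have "mainardi \<nu> x = 0" if "x \<ge> z" for x
    using mainardi_antimono[of \<nu> z x] mainardi_nonneg[of \<nu> x] assms that z by simp
  hence "mainardi \<nu> 0 = 0" by (rule mainardi_eq_0_imp_all_0[rotated 2]) (use assms in auto)
  moreover have "Gamma (1 - \<nu>) > 0" using assms by (intro Gamma_real_pos) auto
  ultimately show False by (simp add: mainardi_0)
qed

subsection \<open>The equation for the free boundary coefficient\<close>

text \<open>The fractional analogue of the complementary error function:
  \<open>\<nu> = 1 / 2\<close> would give \<open>erfc (z / 2)\<close>.\<close>

definition phi :: "real \<Rightarrow> real \<Rightarrow> real" where
  "phi \<nu> z = wright (- z) (- \<nu>) 1"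

lemma phi_0: "phi \<nu> 0 = 1"
  by (simp add: phi_def wright_at_0)

lemma phi_has_real_derivative:
  assumes "0 < \<nu>" "\<nu> < 1"
  shows "(phi \<nu> has_real_derivative - mainardi \<nu> z) (at z)"
  using wright_minus_has_real_derivative[of \<nu> 1 z] assms
  by (simp add: phi_def[abs_def] mainardi_def)

lemma phi_strict_antimono:
  assumes "0 < \<nu>" "\<nu> < 1 / 2" "0 \<le> x" "x < z"
  shows "phi \<nu> z < phi \<nu> x"
proof (rule DERIV_neg_imp_decreasing[OF assms(4)])
  fix u assume "x \<le> u" "u \<le> z"
  thus "\<exists>d. (phi \<nu> has_real_derivative d) (at u) \<and> d < 0"
    using phi_has_real_derivative[of \<nu> u] mainardi_pos[of \<nu> u] assms by (intro exI conjI) auto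
qed

lemma phi_powr_has_real_derivative:
  assumes "0 < \<nu>" "\<nu> < 1" "t > 0"
  shows "((\<lambda>\<tau>. phi \<nu> (y / \<tau> powr \<nu>)) has_real_derivative wright_profile \<nu> 0 y t) (at t)"
proof -
  have "((\<lambda>\<tau>. y / \<tau> powr \<nu>) has_real_derivative - \<nu> * (y / t powr \<nu>) * t powr (- 1)) (at t)"
    using assms by (auto intro!: derivative_eq_intros simp: powr_diff powr_minus field_simps)
  from DERIV_chain2[OF phi_has_real_derivative[OF assms(1,2)] this] show ?thesis
    by (rule DERIV_cong) (use assms in \<open>simp add: wright_profile_0_conv_mainardi\<close>)
qed

text \<open>The \<open>b = 0\<close> profile is a nonnegative density. Its mass beyond
  \<open>a\<close> is \<open>1 - phi \<nu> (1 / a powr \<nu>)\<close>, its mass before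
  \<open>a\<close> is at most \<open>C * a\<close>, and its Laplace transform tends to 1 as
  \<open>s\<close> tends to 0, so small \<open>a\<close> leaves a tail close to 1.\<close>

lemma ex_phi_less:
  assumes \<nu>: "0 < \<nu>" "\<nu> < 1 / 2" and v: "v < 1"
  shows "\<exists>z>0. 1 - phi \<nu> z > v"
proof -
  let ?g = "wright_profile \<nu> 0 1"
  define f where "f = (\<lambda>t. phi \<nu> (1 / t powr \<nu>))"
  obtain C where C: "C > 0" "\<And>t. t > 0 \<Longrightarrow> \<bar>?g t\<bar> \<le> C"
    by (rule wright_profile_bounded[of \<nu> 0 1]) (use \<nu> in auto)
  have g: "laplace_transformable ?g" "\<And>s. s > 0 \<Longrightarrow> laplace ?g s = exp (- (s powr \<nu>))"
    using laplace_wright_profile[of \<nu> 0 1] \<nu> by auto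
  have g_nonneg: "?g t \<ge> 0" if "t > 0" for t
    using wright_profile_0_nonneg[of \<nu> 1 t] \<nu> that by auto
  define g' where "g' = (\<lambda>t. indicator {0<..} t * ?g t)"
  have g'_meas [measurable]: "g' \<in> borel_measurable borel"
    unfolding g'_def
    using borel_measurable_continuous_on_indicator[of "{0::real<..}" ?g] g
    by (simp add: laplace_transformable_def)
  have tail: "(\<integral>\<^sup>+t. ennreal (g' t) * indicator {a..} t \<partial>lborel) = ennreal (1 - f a)" if a: "a > 0" for a
  proof (rule nn_integral_FTC_atLeast)
    show "(f has_real_derivative g' t) (at t)" if "a \<le> t" for t
      using phi_powr_has_real_derivative[of \<nu> t 1] \<nu> a that by (simp add: f_def g'_def)
    have "((\<lambda>t. 1 / t powr \<nu>) \<longlongrightarrow> 0) at_top" using \<nu> by real_asymp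
    moreover have "isCont (phi \<nu>) 0" using phi_has_real_derivative[of \<nu> 0] \<nu> by (intro DERIV_isCont) auto
    ultimately show "(f \<longlongrightarrow> 1) at_top"
      unfolding f_def using isCont_tendsto_compose[of 0 "phi \<nu>"] by (fastforce simp: phi_0)
    show "0 \<le> g' t" if "a \<le> t" for t using g_nonneg a that by (auto simp: g'_def)
  qed (rule g'_meas)
  \<comment> \<open>split the Laplace integral of \<open>?g\<close> at \<open>a\<close>\<close>
  have key: "exp (- (s powr \<nu>)) \<le> C * a + (1 - f a)" if s: "s > 0" and a: "a > 0" for s a
  proof -
    have fa: "1 - f a \<ge> 0"
      using phi_strict_antimono[of \<nu> 0 "1 / a powr \<nu>"] \<nu> a by (simp add: f_def phi_0)
    have nn: "laplace_integrand ?g s 0 t \<ge> 0" for t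
      using g_nonneg by (auto simp: laplace_integrand_def indicator_def)
    have "ennreal (exp (- (s powr \<nu>))) = (\<integral>\<^sup>+t. ennreal (laplace_integrand ?g s 0 t) \<partial>lborel)"
      using g s nn by (subst nn_integral_eq_integral) (auto simp: laplace_transformable_def laplace_def)
    also have "\<dots> \<le> (\<integral>\<^sup>+t. ennreal C * indicator {0..a} t + ennreal (g' t) * indicator {a..} t \<partial>lborel)"
    proof (rule nn_integral_mono)
      fix t :: real
      consider "t \<le> 0" | "0 < t" "t < a" | "t \<ge> a" "t > 0" by linarith
      thus "ennreal (laplace_integrand ?g s 0 t) \<le>
            ennreal C * indicator {0..a} t + ennreal (g' t) * indicator {a..} t"
      proof cases
        case 1
        thus ?thesis by (simp add: laplace_integrand_def)
      next
        case 2
        have "exp (- s * t) * ?g t \<le> 1 * C"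
          using 2 s C(2)[of t] g_nonneg[of t] by (intro mult_mono) auto
        thus ?thesis using 2 by (simp add: laplace_integrand_def ennreal_leI)
      next
        case 3
        have "exp (- s * t) * ?g t \<le> 1 * ?g t"
          using 3 s g_nonneg[of t] by (intro mult_right_mono) auto
        hence "ennreal (laplace_integrand ?g s 0 t) \<le> ennreal (g' t)"
          using 3 by (simp add: laplace_integrand_def g'_def ennreal_leI)
        also have "\<dots> \<le> ennreal C * indicator {0..a} t + ennreal (g' t) * indicator {a..} t"
          using 3 by simp
        finally show ?thesis .
      qed
    qed
    also have "\<dots> = ennreal C * ennreal a + ennreal (1 - f a)"
      using a tail[OF a] by (subst nn_integral_add) (auto simp: nn_integral_cmult_indicator)
    also have "\<dots> = ennreal (C * a + (1 - f a))"
      using C a fa by (simp add: ennreal_mult ennreal_plus)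
    finally show ?thesis using C a fa by (subst (asm) ennreal_le_iff) auto
  qed
  \<comment> \<open>The mass near 0 is allowed \<open>(1 - v) / 2\<close>. With a transform above
    \<open>(1 + v) / 2\<close> the tail then exceeds the difference of the two, which is
    \<open>v\<close>.\<close>
  define a where "a = (1 - v) / (2 * C)"
  have a: "a > 0" "C * a = (1 - v) / 2" using v C by (auto simp: a_def field_simps)
  have "((\<lambda>s. exp (- (s powr \<nu>))) \<longlongrightarrow> 1) (at_right 0)" using \<nu> by real_asymp
  hence "eventually (\<lambda>s. exp (- (s powr \<nu>)) > (1 + v) / 2) (at_right 0)"
    by (rule order_tendstoD) (use v in auto)
  hence "eventually (\<lambda>s. s > 0 \<and> exp (- (s powr \<nu>)) > (1 + v) / 2) (at_right (0::real))"
    using eventually_at_right_less[of "0::real"] by eventually_elim auto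
  then obtain s where s: "s > 0" "exp (- (s powr \<nu>)) > (1 + v) / 2"
    using eventually_happens'[OF trivial_limit_at_right_real] by blast
  have "v < 1 - f a" using key[OF s(1) a(1)] s(2) a(2) by (simp add: field_simps)
  moreover have "1 / a powr \<nu> > 0" using a by simp
  ultimately show ?thesis unfolding f_def by blast
qed

lemma phi_unique_solution:
  assumes \<nu>: "0 < \<nu>" "\<nu> < 1 / 2" and v: "0 < v" "v < 1"
  shows "\<exists>!\<xi>. \<xi> > 0 \<and> 1 - phi \<nu> \<xi> = v"
proof -
  obtain z where z: "z > 0" "1 - phi \<nu> z > v" using ex_phi_less[OF \<nu> v(2)] by blast
  have "\<exists>\<xi>\<ge>0. \<xi> \<le> z \<and> phi \<nu> \<xi> = 1 - v"
  proof (rule IVT2)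
    show "\<forall>x. 0 \<le> x \<and> x \<le> z \<longrightarrow> isCont (phi \<nu>) x"
      using phi_has_real_derivative[of \<nu>] \<nu> by (auto intro: DERIV_isCont)
  qed (use z v in \<open>auto simp: phi_0\<close>)
  then obtain \<xi> where \<xi>: "\<xi> \<ge> 0" "phi \<nu> \<xi> = 1 - v" by blast
  moreover have "\<xi> \<noteq> 0" using \<xi> v by (auto simp: phi_0)
  moreover have "x = y" if "x > 0" "y > 0" "phi \<nu> x = phi \<nu> y" for x y
    using phi_strict_antimono[of \<nu> x y] phi_strict_antimono[of \<nu> y x] that \<nu>
    by (cases x y rule: linorder_cases) auto
  ultimately show ?thesis by (intro ex1I[of _ \<xi>]) auto
qed

subsection \<open>Caputo derivatives and the Stefan problem\<close>

text \<open>Derivatives are only required in the open interval, since the functions below may fail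
  to be differentiable at 0; the values at the two endpoints do not affect the integral.\<close>

lemma caputo_eqI:
  assumes deriv: "\<And>\<tau>. \<tau> \<in> {0<..<t} \<Longrightarrow> (f has_real_derivative f' \<tau>) (at \<tau>)"
  assumes int: "((\<lambda>\<tau>. f' \<tau> / (t - \<tau>) powr \<alpha>) has_integral I) {0<..<t}"
  shows "caputo_exists \<alpha> f t" and "caputo \<alpha> f t = I / Gamma (1 - \<alpha>)"
proof -
  have "((\<lambda>\<tau>. deriv f \<tau> / (t - \<tau>) powr \<alpha>) has_integral I) {0<..<t}"
    using int by (rule has_integral_eq[rotated]) (use deriv DERIV_imp_deriv in force)
  hence "((\<lambda>\<tau>. deriv f \<tau> / (t - \<tau>) powr \<alpha>) has_integral I) {0..t}"
    by (simp add: has_integral_Icc_iff_Ioo)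
  moreover have "\<forall>\<tau>\<in>{0<..<t}. f differentiable (at \<tau>)"
    using deriv unfolding real_differentiable_def by blast
  ultimately show "caputo_exists \<alpha> f t" "caputo \<alpha> f t = I / Gamma (1 - \<alpha>)"
    by (auto simp: caputo_exists_def caputo_def dest: integral_unique)
qed

lemma has_integral_Beta_scaled:
  fixes a b t :: real
  assumes "a > 0" "b > 0" "t > 0"
  shows "((\<lambda>\<tau>. \<tau> powr (a - 1) * (t - \<tau>) powr (b - 1)) has_integral Beta a b * t powr (a + b - 1)) {0..t}"
proof -
  have "((\<lambda>\<tau>. (1 / t * \<tau>) powr (a - 1) * (1 - 1 / t * \<tau>) powr (b - 1)) has_integral
          (1 / \<bar>1 / t\<bar>) *\<^sub>R Beta a b) ((\<lambda>x. x / (1 / t)) ` {0..1})"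
    using assms by (intro has_integral_stretch_real has_integral_Beta_real) auto
  moreover have "(\<lambda>x. x / (1 / t)) ` {0..1} = {0..t}"
    using assms by (simp add: image_mult_atLeastAtMost mult.commute[of _ t])
  ultimately have "((\<lambda>\<tau>. t powr (a + b - 2) * ((1 / t * \<tau>) powr (a - 1) * (1 - 1 / t * \<tau>) powr (b - 1)))
      has_integral t powr (a + b - 2) * (t * Beta a b)) {0..t}"
    using assms by (intro has_integral_mult_right) auto
  moreover have "t powr (a + b - 2) * ((1 / t * \<tau>) powr (a - 1) * (1 - 1 / t * \<tau>) powr (b - 1)) =
                 \<tau> powr (a - 1) * (t - \<tau>) powr (b - 1)" if "\<tau> \<in> {0..t}" for \<tau>
  proof -
    have "\<tau> powr (a - 1) = t powr (a - 1) * (1 / t * \<tau>) powr (a - 1)"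
      using assms that by (subst powr_mult[symmetric]) auto
    moreover have "(t - \<tau>) powr (b - 1) = t powr (b - 1) * (1 - 1 / t * \<tau>) powr (b - 1)"
      using assms that powr_mult[of t "1 - 1 / t * \<tau>" "b - 1"] by (simp add: right_diff_distrib)
    moreover have "t powr (a + b - 2) = t powr (a - 1) * t powr (b - 1)"
      by (simp add: algebra_simps flip: powr_add)
    ultimately show ?thesis by simp
  qed
  ultimately have "((\<lambda>\<tau>. \<tau> powr (a - 1) * (t - \<tau>) powr (b - 1))
      has_integral t powr (a + b - 2) * (t * Beta a b)) {0..t}"
    by (rule has_integral_eq[rotated])
  moreover have "t powr (a + b - 2) * (t * Beta a b) = Beta a b * t powr (a + b - 1)"
    using powr_mult_base[of t "a + b - 2"] assms by (simp add: mult_ac)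
  ultimately show ?thesis by simp
qed

text \<open>The integral is a Beta integral, whose factor \<open>Gamma (1 - \<alpha>)\<close>
  cancels the normalisation of the Caputo derivative.\<close>

lemma caputo_powr:
  fixes \<alpha> \<nu> t C :: real
  assumes "\<alpha> < 1" "\<nu> > 0" "t > 0"
  shows "caputo_exists \<alpha> (\<lambda>\<tau>. C * \<tau> powr \<nu>) t"
    and "caputo \<alpha> (\<lambda>\<tau>. C * \<tau> powr \<nu>) t = C * (Gamma (1 + \<nu>) / Gamma (1 + \<nu> - \<alpha>)) * t powr (\<nu> - \<alpha>)"
proof -
  let ?I = "C * \<nu> * (Beta \<nu> (1 - \<alpha>) * t powr (\<nu> + (1 - \<alpha>) - 1))"
  have "((\<lambda>\<tau>. C * \<nu> * (\<tau> powr (\<nu> - 1) * (t - \<tau>) powr (1 - \<alpha> - 1))) has_integral ?I) {0<..<t}"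
    using has_integral_mult_right[OF has_integral_Beta_scaled[of \<nu> "1 - \<alpha>" t], of "C * \<nu>"] assms
    by (simp add: has_integral_Icc_iff_Ioo)
  hence int: "((\<lambda>\<tau>. (C * \<nu> * \<tau> powr (\<nu> - 1)) / (t - \<tau>) powr \<alpha>) has_integral ?I) {0<..<t}"
    by (rule has_integral_eq[rotated]) (simp add: powr_minus field_simps)
  have der: "((\<lambda>\<tau>. C * \<tau> powr \<nu>) has_real_derivative C * \<nu> * \<tau> powr (\<nu> - 1)) (at \<tau>)"
    if "\<tau> \<in> {0<..<t}" for \<tau>
    using that by (auto intro!: derivative_eq_intros)
  show "caputo_exists \<alpha> (\<lambda>\<tau>. C * \<tau> powr \<nu>) t"
    by (rule caputo_eqI(1)[OF der int])
  have "\<nu> \<notin> \<int>\<^sub>\<le>\<^sub>0" using assms nonpos_Ints_nonpos by force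
  hence "\<nu> * Gamma \<nu> = Gamma (1 + \<nu>)"
    using Gamma_plus1[of \<nu>] by (simp add: add.commute)
  moreover have "Gamma (1 - \<alpha>) > 0" using assms by (intro Gamma_real_pos) auto
  ultimately have "?I / Gamma (1 - \<alpha>) = C * (Gamma (1 + \<nu>) / Gamma (1 + \<nu> - \<alpha>)) * t powr (\<nu> - \<alpha>)"
    by (simp add: Beta_def add_ac diff_add_eq) (simp add: field_simps)
  thus "caputo \<alpha> (\<lambda>\<tau>. C * \<tau> powr \<nu>) t = C * (Gamma (1 + \<nu>) / Gamma (1 + \<nu> - \<alpha>)) * t powr (\<nu> - \<alpha>)"
    using caputo_eqI(2)[OF der int] by simp
qed

lemma caputo_phi:
  fixes \<nu> y t A B :: real
  assumes \<nu>: "0 < \<nu>" "\<nu> < 1 / 2" and y: "y > 0" and t: "t > 0"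
  defines "f \<equiv> (\<lambda>\<tau>. B + A * phi \<nu> (y / \<tau> powr \<nu>))"
  shows "caputo_exists (2 * \<nu>) f t"
    and "caputo (2 * \<nu>) f t = A * wright_profile \<nu> (1 - 2 * \<nu>) y t"
proof -
  let ?g = "wright_profile \<nu> 0 y"
  obtain C where C: "\<And>t. t > 0 \<Longrightarrow> \<bar>?g t\<bar> \<le> C"
    by (rule wright_profile_bounded[of \<nu> 0 y]) (use \<nu> y in auto)
  have "continuous_on {0<..} ?g" using \<nu> by (intro continuous_on_wright_profile) auto
  hence "integrable lborel (abel_integrand (2 * \<nu>) ?g t)"
    using \<nu> by (intro integrable_abel_integrand[OF _ _ C t]) auto
  from has_integral_mult_right[OF has_integral_abel[OF t this], of A]
  have int: "((\<lambda>\<tau>. (A * ?g \<tau>) / (t - \<tau>) powr (2 * \<nu>)) has_integral A * abel (2 * \<nu>) ?g t) {0<..<t}"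
    by simp
  have der: "(f has_real_derivative A * ?g \<tau>) (at \<tau>)" if "\<tau> \<in> {0<..<t}" for \<tau>
    unfolding f_def
    using DERIV_add[OF DERIV_const DERIV_cmult[OF phi_powr_has_real_derivative[of \<nu> \<tau> y]], of B A] \<nu> that by simp
  show "caputo_exists (2 * \<nu>) f t" by (rule caputo_eqI(1)[OF der int])
  have "Gamma (1 - 2 * \<nu>) \<noteq> 0" using Gamma_real_pos[of "1 - 2 * \<nu>"] \<nu> by linarith
  thus "caputo (2 * \<nu>) f t = A * wright_profile \<nu> (1 - 2 * \<nu>) y t"
    using caputo_eqI(2)[OF der int] abel_wright_profile[of \<nu> "2 * \<nu>" y t] \<nu> y t by simp
qed

section \<open>Verification of the Stefan conditions\<close>

lemma phi_scaled_has_real_derivative: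
  assumes "0 < \<nu>" "\<nu> < 1"
  shows "((\<lambda>z. B + A * phi \<nu> (z / d)) has_real_derivative - (A / d) * mainardi \<nu> (x / d)) (at x)"
  using DERIV_add[OF DERIV_const DERIV_cmult[OF DERIV_chain2[OF phi_has_real_derivative[OF assms]
          DERIV_cdivide[OF DERIV_ident]]], of B A]
  by simp

lemma mainardi_scaled_has_real_derivative:
  assumes "0 < \<nu>" "\<nu> < 1"
  shows "((\<lambda>z. C * mainardi \<nu> (z / d)) has_real_derivative
            - (C / d) * wright (- (x / d)) (- \<nu>) (1 - 2 * \<nu>)) (at x)"
  using DERIV_cmult[OF DERIV_chain2[OF mainardi_has_real_derivative[OF assms] DERIV_cdivide[OF DERIV_ident]], of C]
  by simp

lemma stefan_case2_solution:
  fixes \<alpha> \<rho> k c Tm T0 q0 \<xi> :: real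
  assumes \<alpha>: "0 < \<alpha>" "\<alpha> < 1" and pos: "\<rho> > 0" "k > 0" "c > 0" "q0 > 0" and T: "T0 > Tm"
    and \<xi>: "\<xi> > 0" "1 - wright (- \<xi>) (- \<alpha> / 2) 1 = sqrt (\<rho> * c * k) * (T0 - Tm) / (q0 * Gamma (1 - \<alpha> / 2))"
  shows "stefan_case2 \<alpha> \<rho> k c Tm T0 q0 (ell_sol \<alpha> c Tm T0 \<xi>) (T_sol \<alpha> \<rho> k c Tm T0 \<xi>) (s_sol \<alpha> \<rho> k c \<xi>)"
proof -
  define \<nu> where "\<nu> = \<alpha> / 2"
  have \<nu>: "0 < \<nu>" "\<nu> < 1 / 2" "\<nu> < 1" and \<alpha>_eq: "\<alpha> = 2 * \<nu>" and m\<nu>: "- \<alpha> / 2 = - \<nu>"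
    using \<alpha> by (auto simp: \<nu>_def)
  define v where "v = 1 - phi \<nu> \<xi>"
  define G where "G = Gamma (1 - \<nu>)"
  define M where "M = mainardi \<nu> \<xi>"
  define \<Lambda> where "\<Lambda> = lam \<rho> k c"
  \<comment> \<open>The amplitude for which \<open>T0 - A + A * phi\<close> equals \<open>T0\<close>
    at argument 0 and \<open>Tm\<close> at argument \<open>\<xi>\<close>.\<close>
  define A where "A = (T0 - Tm) / v"
  have G: "G > 0" "Gamma (1 + \<nu>) > 0" using \<nu> by (auto simp: G_def intro!: Gamma_real_pos)
  have M: "M > 0" unfolding M_def using \<nu> \<xi> by (intro mainardi_pos) auto
  have \<Lambda>: "\<Lambda> > 0" "\<Lambda> * \<Lambda> = k / (\<rho> * c)" using pos by (simp_all add: \<Lambda>_def lam_def)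
  have v: "v = sqrt (\<rho> * c * k) * (T0 - Tm) / (q0 * G)"
    using \<xi>(2) by (simp add: v_def phi_def m\<nu> G_def \<nu>_def)
  have v_pos: "v > 0" unfolding v using pos T G by simp
  have A_pos: "A > 0" using T v_pos by (simp add: A_def)
  \<comment> \<open>In this form the equation for \<open>\<xi>\<close> says
    \<open>k * A / (\<Lambda> * G) = q0\<close>, which is the flux condition at
    \<open>x = 0\<close>.\<close>
  have sqrt_eq: "sqrt (\<rho> * c * k) = k / \<Lambda>"
  proof -
    have "(k / \<Lambda>)\<^sup>2 = \<rho> * c * k"
      using pos \<Lambda> by (simp add: power2_eq_square field_simps)
    thus ?thesis using pos \<Lambda> by (intro real_sqrt_unique) auto
  qed
  define Ts where "Ts = T_sol \<alpha> \<rho> k c Tm T0 \<xi>"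
  define s where "s = s_sol \<alpha> \<rho> k c \<xi>"
  define L where "L = ell_sol \<alpha> c Tm T0 \<xi>"
  have Ts: "Ts x t = (T0 - A) + A * phi \<nu> (x / (\<Lambda> * t powr \<nu>))" for x t
    unfolding Ts_def T_sol_def m\<nu> \<Lambda>_def A_def v_def phi_def \<nu>_def[symmetric]
    by (simp add: algebra_simps)
  have s: "s t = \<Lambda> * \<xi> * t powr \<nu>" for t
    by (simp add: s_def s_sol_def \<Lambda>_def \<nu>_def)
  have L: "L = c * (T0 - Tm) * G * M / (Gamma (1 + \<nu>) * \<xi> * v)"
    unfolding L_def ell_sol_def F4_def m\<nu> \<nu>_def[symmetric] G_def v_def phi_def M_def by simp
  have L_pos: "L > 0" unfolding L using pos T G M \<xi> v_pos by simp
  have T_x: "((\<lambda>z. Ts z t) has_real_derivative - (A / d) * mainardi \<nu> (x / d)) (at x)"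
    if "d = \<Lambda> * t powr \<nu>" for x t d
    unfolding Ts that using \<nu> by (intro phi_scaled_has_real_derivative) auto
  have deriv_T: "deriv (\<lambda>z. Ts z t) = (\<lambda>x. - (A / d) * mainardi \<nu> (x / d))"
    if "d = \<Lambda> * t powr \<nu>" for t d
    using T_x[OF that] by (intro ext DERIV_imp_deriv)
  have T_xx: "(deriv (\<lambda>z. Ts z t) has_real_derivative
                (A / d) / d * wright (- (x / d)) (- \<nu>) (1 - 2 * \<nu>)) (at x)"
    if "d = \<Lambda> * t powr \<nu>" for x t d
    using mainardi_scaled_has_real_derivative[of \<nu> "- (A / d)" d x] \<nu> unfolding deriv_T[OF that] by simp
  have \<xi>_arg: "s t / (\<Lambda> * t powr \<nu>) = \<xi>" if "t > 0" for t
    using that \<Lambda> by (simp add: s)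
  have heat: "caputo_exists \<alpha> (\<lambda>\<tau>. Ts x \<tau>) t"
             "caputo \<alpha> (\<lambda>\<tau>. Ts x \<tau>) t = (k / (\<rho> * c)) * deriv (deriv (\<lambda>z. Ts z t)) x"
    if t: "t > 0" and x: "x > 0" for t x
  proof -
    define d where "d = \<Lambda> * t powr \<nu>"
    have y: "x / \<Lambda> > 0" using x \<Lambda> by simp
    have Ts': "(\<lambda>\<tau>. Ts x \<tau>) = (\<lambda>\<tau>. (T0 - A) + A * phi \<nu> (x / \<Lambda> / \<tau> powr \<nu>))"
      by (simp add: Ts fun_eq_iff)
    show "caputo_exists \<alpha> (\<lambda>\<tau>. Ts x \<tau>) t"
      unfolding Ts' \<alpha>_eq by (rule caputo_phi(1)[OF \<nu>(1,2) y t])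
    have "caputo \<alpha> (\<lambda>\<tau>. Ts x \<tau>) t = A * wright_profile \<nu> (1 - 2 * \<nu>) (x / \<Lambda>) t"
      unfolding Ts' \<alpha>_eq by (rule caputo_phi(2)[OF \<nu>(1,2) y t])
    also have "\<dots> = A * (t powr (- (2 * \<nu>)) * wright (- (x / d)) (- \<nu>) (1 - 2 * \<nu>))"
      by (simp add: wright_profile_def d_def)
    \<comment> \<open>The power of \<open>t\<close> in the profile becomes the factor
      \<open>1 / (d * d)\<close> created by two spatial derivatives, times
      \<open>\<Lambda> * \<Lambda>\<close>.\<close>
    also have "t powr (- (2 * \<nu>)) = (k / (\<rho> * c)) / (d * d)"
    proof -
      have "d * d = (\<Lambda> * \<Lambda>) * t powr (2 * \<nu>)"
        by (simp add: d_def algebra_simps flip: powr_add)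
      thus ?thesis using pos t unfolding \<Lambda>(2) by (simp add: powr_minus field_simps)
    qed
    finally show "caputo \<alpha> (\<lambda>\<tau>. Ts x \<tau>) t = (k / (\<rho> * c)) * deriv (deriv (\<lambda>z. Ts z t)) x"
      using DERIV_imp_deriv[OF T_xx[OF d_def, of x]] by simp
  qed
  have flux: "caputo_exists \<alpha> s t" "- k * deriv (\<lambda>z. Ts z t) (s t) = \<rho> * L * caputo \<alpha> s t"
    if t: "t > 0" for t
  proof -
    have s': "s = (\<lambda>\<tau>. (\<Lambda> * \<xi>) * \<tau> powr \<nu>)" by (simp add: s fun_eq_iff)
    show "caputo_exists \<alpha> s t" unfolding s' by (rule caputo_powr(1)[OF \<alpha>(2) \<nu>(1) t])
    have "caputo \<alpha> s t = (\<Lambda> * \<xi>) * (Gamma (1 + \<nu>) / G) * t powr (- \<nu>)"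
      unfolding s' caputo_powr(2)[OF \<alpha>(2) \<nu>(1) t] by (simp add: \<alpha>_eq G_def)
    \<comment> \<open>The latent heat is built to cancel the front: the grouped quotients are the
      Gamma factors and \<open>\<xi>\<close>, each appearing once in \<open>L\<close> and once in
      the Caputo derivative of \<open>s\<close>.\<close>
    hence "\<rho> * L * caputo \<alpha> s t = (\<rho> * c * \<Lambda>) * A * M * t powr (- \<nu>) *
             ((G / G) * (\<xi> / \<xi>) * (Gamma (1 + \<nu>) / Gamma (1 + \<nu>)))"
      unfolding L A_def by simp
    hence "\<rho> * L * caputo \<alpha> s t = (\<rho> * c * \<Lambda>) * A * M * t powr (- \<nu>)"
      using G \<xi>(1) by simp
    also have "\<rho> * c * \<Lambda> = k / \<Lambda>" using \<Lambda> pos by (simp add: field_simps)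
    also have "k / \<Lambda> * A * M * t powr (- \<nu>) = - k * deriv (\<lambda>z. Ts z t) (s t)"
      unfolding deriv_T[OF refl] \<xi>_arg[OF t] M_def[symmetric] by (simp add: powr_minus field_simps)
    finally show "- k * deriv (\<lambda>z. Ts z t) (s t) = \<rho> * L * caputo \<alpha> s t" ..
  qed
  have flux0: "k * deriv (\<lambda>z. Ts z t) 0 = - q0 / t powr (\<alpha> / 2)" if t: "t > 0" for t
  proof -
    have "k / \<Lambda> * (A / G) = q0"
      unfolding A_def v sqrt_eq using pos T G \<Lambda> by (simp add: field_simps)
    hence "k * (- (A / (\<Lambda> * t powr \<nu>)) * (1 / G)) = - q0 / t powr \<nu>"
      using \<Lambda> G t by (simp add: field_simps)
    thus ?thesis by (simp add: deriv_T[OF refl] mainardi_0 G_def \<nu>_def mult_ac)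
  qed
  have "stefan_case2 \<alpha> \<rho> k c Tm T0 q0 L Ts s"
    unfolding stefan_case2_def
  proof (intro conjI allI impI)
    show "(\<lambda>z. Ts z t) differentiable at y" for t y
      using T_x[OF refl] by (auto simp: real_differentiable_def)
    show "deriv (\<lambda>z. Ts z t) differentiable at x" for t x
      using T_xx[OF refl] by (auto simp: real_differentiable_def)
    show "s 0 = 0" by (simp add: s)
    \<comment> \<open>The front starts at 0, so at time 0 every \<open>x > 0\<close> lies in the
      solid region.\<close>
    show "one_phase_temp Ts s Tm x 0 = Tm" if "x > 0" for x
      using that by (simp add: one_phase_temp_def s)
    show "((\<lambda>x. one_phase_temp Ts s Tm x t) \<longlongrightarrow> Tm) at_top" for t
    proof (rule tendsto_eventually)
      show "\<forall>\<^sub>F x in at_top. one_phase_temp Ts s Tm x t = Tm"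
        using eventually_gt_at_top[of "s t"] by eventually_elim (simp add: one_phase_temp_def)
    qed
    show "Ts (s t) t = Tm" if "t > 0" for t
    proof -
      have "A * v = T0 - Tm" using v_pos by (simp add: A_def)
      thus ?thesis unfolding Ts \<xi>_arg[OF that] by (simp add: v_def right_diff_distrib)
    qed
    show "Ts 0 t = T0" for t by (simp add: Ts phi_0)
  qed (use L_pos heat flux flux0 in auto)
  thus ?thesis by (simp add: L_def Ts_def s_def)
qed

theorem theorem4:
  fixes \<alpha> \<rho> k c Tm T0 q0 :: real
  assumes "0 < \<alpha>" "\<alpha> < 1" "\<rho> > 0" "k > 0" "c > 0" "T0 > Tm" "q0 > 0"
    and "sqrt (\<rho> * c * k) * (T0 - Tm) / (q0 * Gamma (1 - \<alpha> / 2)) < 1"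
  shows "(\<exists>!\<xi>. \<xi> > 0 \<and> 1 - wright (- \<xi>) (- \<alpha> / 2) 1 =
                 sqrt (\<rho> * c * k) * (T0 - Tm) / (q0 * Gamma (1 - \<alpha> / 2))) \<and>
         (\<forall>\<xi>. \<xi> > 0 \<and> 1 - wright (- \<xi>) (- \<alpha> / 2) 1 =
                 sqrt (\<rho> * c * k) * (T0 - Tm) / (q0 * Gamma (1 - \<alpha> / 2)) \<longrightarrow>
            stefan_case2 \<alpha> \<rho> k c Tm T0 q0 (ell_sol \<alpha> c Tm T0 \<xi>)
              (T_sol \<alpha> \<rho> k c Tm T0 \<xi>) (s_sol \<alpha> \<rho> k c \<xi>))"
proof (intro conjI allI impI)
  have "Gamma (1 - \<alpha> / 2) > 0" using assms by (intro Gamma_real_pos) auto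
  hence "sqrt (\<rho> * c * k) * (T0 - Tm) / (q0 * Gamma (1 - \<alpha> / 2)) > 0" using assms by simp
  from phi_unique_solution[OF _ _ this assms(8), of "\<alpha> / 2"]
  show "\<exists>!\<xi>. \<xi> > 0 \<and> 1 - wright (- \<xi>) (- \<alpha> / 2) 1 =
                 sqrt (\<rho> * c * k) * (T0 - Tm) / (q0 * Gamma (1 - \<alpha> / 2))"
    using assms by (simp add: phi_def)
qed (use assms in \<open>auto intro!: stefan_case2_solution\<close>)

end
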